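(* Let $V$ be a finite-dimensional real inner product space, let $g\colon V\to(-\infty,+\infty]$ be a proper convex lower semicontinuous function, and let $F\colon \operatorname{dom} g\to V$ be monotone, i.e. $\langle F(u)-F(v),u-v\rangle\ge 0$ for all $u,v\in\operatorname{dom} g$, and locally Lipschitz. Assume that the solution set of the variational inequality $$\text{find } z^*\in V \text{ such that } \langle F(z^* ),z-z^*\rangle+g(z)-g(z^* )\ge 0\quad \forall z\in V$$ is nonempty. Let $(z^k)$ and $(\lambda_k)$ be generated by the adaptive Golden Ratio Algorithm (aGRAAL, described in the context), and define the ergodic sequence $$Z^k=\frac{\sum_{i=1}^k\lambda_iz^i}{\sum_{i=1}^k\lambda_i},\qquad k\ge1.$$ Let $\tilde x\in\operatorname{dom} g$ and $r>0$ be arbitrary, let $U=\operatorname{dom} g\cap\mathbb B(\tilde x,r)$, and let $e_r(v)=\sup_{u\in U}\bigl(\langle F(u),v-u\rangle+g(v)-g(u)\bigr)$ for $v\in V$. Then there exists a constant $M>0$ such that for all $k\ge1$ $$e_r(Z^k)\le\frac{M}{\sum_{i=1}^k\lambda_i},$$ and consequently $e_r(Z^k)$ is bounded above by a constant multiple of $1/k$ (an $O(1/k)$ ergodic convergence rate).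
   Context: $\|\cdot\|=\sqrt{\langle\cdot,\cdot\rangle}$; $\operatorname{dom} g=\{x\in V: g(x)<+\infty\}$; $\mathbb B(\tilde x,r)$ is the closed ball with center $\tilde x$ and radius $r$; for $\lambda>0$, $\operatorname{prox}_{\lambda g}(z)=\operatorname{argmin}_{x\in V}\{\lambda g(x)+\frac12\|x-z\|^2\}$. Solutions $z^*$ of the variational inequality are understood to lie in $\operatorname{dom} g$. Adaptive Golden Ratio Algorithm (aGRAAL). Let $\varphi=\frac{\sqrt5+1}{2}$. Input: $z^0,z^1\in\operatorname{dom} g$, $\lambda_0>0$, $\phi\in(1,\varphi]$, $\bar\lambda>0$. Set $\bar z^0=z^1$, $\theta_0=1$, $\rho=\frac1\phi+\frac1{\phi^2}$. For $k\ge1$: 1. $\displaystyle \lambda_k=\min\Bigl\{\rho\lambda_{k-1},\ \frac{\phi\,\theta_{k-1}}{4\lambda_{k-1}}\frac{\|z^k-z^{k-1}\|^2}{\|F(z^k)-F(z^{k-1})\|^2},\ \bar\lambda\Bigr\}$, where a quotient with zero denominator (including $\frac00$) is taken to be $+\infty$; 2. $\displaystyle \bar z^k=\frac{(\phi-1)z^k+\bar z^{k-1}}{\phi}$, $\quad z^{k+1}=\operatorname{prox}_{\lambda_k g}(\bar z^k-\lambda_kF(z^k))$; 3. $\displaystyle \theta_k=\phi\,\frac{\lambda_k}{\lambda_{k-1}}$. *)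

theory Defs
  imports "HOL-Analysis.Analysis"
begin

definition effdom :: "('a \<Rightarrow> ereal) \<Rightarrow> 'a set"
  where "effdom g = {x. g x < \<infinity>}"

definition proper_fun :: "('a \<Rightarrow> ereal) \<Rightarrow> bool"
  where "proper_fun g \<longleftrightarrow> (\<forall>x. g x \<noteq> -\<infinity>) \<and> effdom g \<noteq> {}"

(* Only used together with proper_fun, so the right-hand side never is of the form \<infinity> - \<infinity>;
   in ereal, 0 * \<infinity> = 0. *)
definition convex_fun :: "('a::real_vector \<Rightarrow> ereal) \<Rightarrow> bool"
  where "convex_fun g \<longleftrightarrow>
    (\<forall>x y. \<forall>u\<ge>0. \<forall>v\<ge>0. u + v = 1 \<longrightarrow>
      g (u *\<^sub>R x + v *\<^sub>R y) \<le> ereal u * g x + ereal v * g y)"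

definition lsc_fun :: "('a::topological_space \<Rightarrow> ereal) \<Rightarrow> bool"
  where "lsc_fun g \<longleftrightarrow> (\<forall>x. g x \<le> Liminf (at x) g)"

definition monotone_operator_on :: "'a set \<Rightarrow> ('a::real_inner \<Rightarrow> 'a) \<Rightarrow> bool"
  where "monotone_operator_on D F \<longleftrightarrow>
    (\<forall>u\<in>D. \<forall>v\<in>D. inner (F u - F v) (u - v) \<ge> 0)"

(* The neighbourhoods are relative to D, and the Lipschitz constant depends on the point. *)
definition locally_lipschitz_on :: "'a set \<Rightarrow> ('a::metric_space \<Rightarrow> 'b::metric_space) \<Rightarrow> bool"
  where "locally_lipschitz_on D F \<longleftrightarrow>
    (\<forall>x\<in>D. \<exists>\<delta>>0. \<exists>L. L-lipschitz_on (cball x \<delta> \<inter> D) F)"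

definition VI_solutions :: "('a::real_inner \<Rightarrow> ereal) \<Rightarrow> ('a \<Rightarrow> 'a) \<Rightarrow> 'a set"
  where "VI_solutions g F =
    {zs \<in> effdom g. \<forall>z. ereal (inner (F zs) (z - zs)) + g z - g zs \<ge> 0}"

(* For a proper convex lower semicontinuous g the minimizer exists and is unique. *)
definition prox :: "real \<Rightarrow> ('a::real_inner \<Rightarrow> ereal) \<Rightarrow> 'a \<Rightarrow> 'a"
  where "prox t g z = arg_min (\<lambda>x. ereal t * g x + ereal (1/2 * (norm (x - z))\<^sup>2)) (\<lambda>_. True)"

definition quot :: "real \<Rightarrow> real \<Rightarrow> ereal"
  where "quot a b = (if b = 0 then \<infinity> else ereal (a / b))"

(* z, zb, lam, th are the sequences z^k, \<open>\<bar>z\<close>^k, \<open>\<lambda>\<^sub>k\<close>, \<open>\<theta>\<^sub>k\<close>; lbar is the upper bound for the steps. *)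
definition aGRAAL ::
  "('a::real_inner \<Rightarrow> ereal) \<Rightarrow> ('a \<Rightarrow> 'a) \<Rightarrow> real \<Rightarrow> real \<Rightarrow>
    (nat \<Rightarrow> 'a) \<Rightarrow> (nat \<Rightarrow> 'a) \<Rightarrow> (nat \<Rightarrow> real) \<Rightarrow> (nat \<Rightarrow> real) \<Rightarrow> bool"
  where "aGRAAL g F \<phi> lbar z zb lam th \<longleftrightarrow>
    z 0 \<in> effdom g \<and> z 1 \<in> effdom g \<and> lam 0 > 0 \<and>
    1 < \<phi> \<and> \<phi> \<le> (sqrt 5 + 1) / 2 \<and> lbar > 0 \<and>
    zb 0 = z 1 \<and> th 0 = 1 \<and>
    (\<forall>k\<ge>1.
      ereal (lam k) =
        min (ereal ((1 / \<phi> + 1 / \<phi>\<^sup>2) * lam (k - 1)))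
          (min (ereal (\<phi> * th (k - 1) / (4 * lam (k - 1))) *
                 quot ((norm (z k - z (k - 1)))\<^sup>2) ((norm (F (z k) - F (z (k - 1))))\<^sup>2))
               (ereal lbar)) \<and>
      zb k = ((\<phi> - 1) *\<^sub>R z k + zb (k - 1)) /\<^sub>R \<phi> \<and>
      z (k + 1) = prox (lam k) g (zb k - lam k *\<^sub>R F (z k)) \<and>
      th k = \<phi> * lam k / lam (k - 1))"

definition ergodic :: "(nat \<Rightarrow> real) \<Rightarrow> (nat \<Rightarrow> 'a::real_vector) \<Rightarrow> nat \<Rightarrow> 'a"
  where "ergodic lam z k = (\<Sum>i=1..k. lam i *\<^sub>R z i) /\<^sub>R (\<Sum>i=1..k. lam i)"

definition restricted_gap ::
  "('a::real_inner \<Rightarrow> ereal) \<Rightarrow> ('a \<Rightarrow> 'a) \<Rightarrow> 'a \<Rightarrow> real \<Rightarrow> 'a \<Rightarrow> ereal"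
  where "restricted_gap g F xt r v =
    (SUP u\<in>effdom g \<inter> cball xt r. ereal (inner (F u) (v - u)) + g v - g u)"

end

(* For every p in dom g the energy
   \<phi>/(\<phi>-1) |zb_k - p|^2 + \<theta>_{k-1}/2 |z_k - z_{k-1}|^2 decreases from k to k+1 by at least
   2 \<lambda>_k (<F p, z_k - p> + g z_k - g p). Summing and using Jensen's inequality gives the first bound.

   For the 1/k rate the steps must stay away from zero, i.e. F must be Lipschitz along the iterates.
   As dom g need not be closed, boundedness of z does not suffice: one needs that every cluster
   point b of z lies in dom g. Otherwise g(z_k) is unbounded near b, while the total time
   (sum of \<lambda>_k) spent where g is large is finite.
   If g(z_k) is small infinitely often, then during an excursion from a point p of low g the
   energy at p hardly grows, so the excursion ends near p, and closedness of sublevel sets puts b in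
   dom g. If g(z_k) is eventually large, then the whole sequence converges to b; the explosion of g
   then pushes zb_k - b into a direction having nonpositive inner product with every p - b, p in dom g.
   Taking p = zb_j, a limit u of the unit directions satisfies <u,u> \<le> 0. *)
theory Submission
  imports Defs
begin

text \<open>Both weights of the dissipation in the energy inequality, \<open>th\<close> and
  \<open>1 + 1 / \<phi> - th\<close>, may come close to 0; only their sum is a positive constant.
  The vanishing of \<open>z k - zb k\<close>, on which every argument about cluster points rests,
  therefore needs a case distinction over two consecutive steps. The time spent where g is large is
  finite because the gap at a solution is at least 1 there, while the weighted gaps at a solution
  have a finite sum. A cluster point outside dom g cannot serve as reference point of an energy, and
  F need not be bounded near it. Reference points are taken in dom g instead, and monotonicity moves
  the argument of F from the iterates to a neighbourhood of a fixed point of dom g. As dom g may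
  have empty interior, upper bounds of g come from relative interiors of polytopes with vertices in
  dom g.\<close>

section \<open>Closed convex functions and proximal points\<close>

text \<open>\<open>D\<close> and \<open>G\<close> stand for the effective domain and the finite
  values of g, so that all estimates are between real numbers. \<open>closed_epigraph\<close> is
  sequential closedness of the epigraph: it forces the limit into \<open>D\<close>, although
  \<open>D\<close> need not be closed, and the varying bound \<open>c\<close> leaves room for
  continuous terms on the right-hand side.\<close>

locale closed_convex_function =
  fixes D :: "'a::euclidean_space set" and G :: "'a \<Rightarrow> real"
  assumes convex_on_G: "convex_on D G"
    and closed_epigraph: "\<And>X x c l. (\<And>n. X n \<in> D) \<Longrightarrow> X \<longlonglongrightarrow> x \<Longrightarrow> (\<And>n. G (X n) \<le> c n) \<Longrightarrow>
      c \<longlonglongrightarrow> l \<Longrightarrow> x \<in> D \<and> G x \<le> l"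
begin

lemma convex_D: "convex D"
  using convex_on_G by (rule convex_on_imp_convex)

lemma convex_sublevel: "convex {x \<in> D. G x \<le> c}"
proof (rule convexI)
  fix x y :: 'a and u v :: real
  assume xy: "x \<in> {x \<in> D. G x \<le> c}" "y \<in> {x \<in> D. G x \<le> c}" and uv: "0 \<le> u" "0 \<le> v" "u + v = 1"
  have "G (u *\<^sub>R x + v *\<^sub>R y) \<le> u * G x + v * G y"
    using convex_on_G xy uv unfolding convex_on_def by blast
  also have "\<dots> \<le> u * c + v * c"
    using xy uv by (intro add_mono mult_left_mono) auto
  also have "\<dots> = c" using uv by (metis distrib_right mult_1)
  finally show "u *\<^sub>R x + v *\<^sub>R y \<in> {x \<in> D. G x \<le> c}"
    using convexD[OF convex_D _ _ uv, of x y] xy by auto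
qed

text \<open>Values tending to minus infinity along a bounded sequence would give a limit point a
  value below every \<open>- real N\<close>.\<close>

lemma bounded_below_on_bounded:
  assumes "bounded S"
  shows "\<exists>m. \<forall>x\<in>D \<inter> S. m \<le> G x"
proof (rule ccontr)
  assume "\<not> ?thesis"
  then have "\<forall>n. \<exists>x\<in>D \<inter> S. G x < - real n" by (meson not_le)
  then obtain X where X: "\<And>n. X n \<in> D" "\<And>n. X n \<in> S" "\<And>n. G (X n) < - real n" by (metis IntE)
  have "bounded (range X)" using assms X(2) by (metis bounded_subset image_subsetI)
  then obtain x r where r: "strict_mono (r :: nat \<Rightarrow> nat)" "(X \<circ> r) \<longlonglongrightarrow> x"
    using bounded_imp_convergent_subsequence by blast
  have *: "G x \<le> - real N" for N
  proof -
    have "(\<lambda>n. (X \<circ> r) (n + N)) \<longlonglongrightarrow> x" using r(2) by (rule LIMSEQ_ignore_initial_segment)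
    moreover have "G ((X \<circ> r) (n + N)) \<le> - real N" for n
    proof -
      have "N \<le> r (n + N)" using seq_suble[OF r(1), of "n + N"] by simp
      then show ?thesis using X(3)[of "r (n + N)"] by simp
    qed
    ultimately show ?thesis
      using closed_epigraph[of "\<lambda>n. (X \<circ> r) (n + N)" x "\<lambda>_. - real N"] X(1) by auto
  qed
  obtain N where "- G x < real N" using reals_Archimedean2 by blast
  with *[of N] show False by simp
qed

lemma tends_to_infinity_outside:
  assumes "\<And>n. X n \<in> D" "X \<longlonglongrightarrow> b" "b \<notin> D"
  shows "\<forall>\<^sub>F n in sequentially. c < G (X n)"
proof (rule ccontr)
  assume "\<not> ?thesis"
  then have "\<exists>\<^sub>\<infinity>n. G (X n) \<le> c"
    by (simp add: not_eventually frequently_cofinite cofinite_eq_sequentially[symmetric] not_less)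
  then have "infinite {n. G (X n) \<le> c}" by (simp add: frequently_cofinite)
  then obtain r where r: "strict_mono (r :: nat \<Rightarrow> nat)" "\<And>n. r n \<in> {n. G (X n) \<le> c}"
    using infinite_enumerate by blast
  have "b \<in> D \<and> G b \<le> c"
    using closed_epigraph[of "X \<circ> r" b "\<lambda>_. c" c] LIMSEQ_subseq_LIMSEQ[OF assms(2) r(1)] r(2) assms(1)
    by auto
  then show False using assms(3) by simp
qed

text \<open>A lower bound on the unit ball around \<open>x0\<close> spreads along rays by convexity
  and takes the place of an affine minorant. For \<open>y\<close> outside the ball it is used at the
  point \<open>w\<close> of the segment from \<open>x0\<close> to \<open>y\<close> at distance 1
  from \<open>x0\<close>.\<close>

lemma linear_lower_bound:
  assumes "x0 \<in> D"
  shows "\<exists>\<kappa>\<ge>0. \<forall>y\<in>D. - \<kappa> * (1 + norm (y - x0)) \<le> G y"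
proof -
  obtain m where m: "\<And>x. x \<in> D \<Longrightarrow> x \<in> cball x0 1 \<Longrightarrow> m \<le> G x"
    using bounded_below_on_bounded[OF bounded_cball, of x0 1] by (meson IntI)
  define \<kappa> where "\<kappa> = \<bar>m\<bar> + \<bar>G x0\<bar>"
  have "- \<kappa> * (1 + norm (y - x0)) \<le> G y" if y: "y \<in> D" for y
  proof (cases "norm (y - x0) \<le> 1")
    case True
    then have "m \<le> G y" using m y by (simp add: dist_norm norm_minus_commute)
    moreover have "\<kappa> * 1 \<le> \<kappa> * (1 + norm (y - x0))" by (intro mult_left_mono) (auto simp: \<kappa>_def)
    moreover have "- \<kappa> \<le> m" unfolding \<kappa>_def by linarith
    ultimately show ?thesis by (simp add: algebra_simps)
  next
    case False
    define t where "t = norm (y - x0)"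
    have t: "t > 1" using False t_def by simp
    define w where "w = (1 - 1/t) *\<^sub>R x0 + (1/t) *\<^sub>R y"
    have w: "w - x0 = (1/t) *\<^sub>R (y - x0)" unfolding w_def by (simp add: algebra_simps)
    then have "norm (w - x0) = 1" using t unfolding t_def by auto
    moreover have "w \<in> D" unfolding w_def using t y assms convex_D
      by (intro convexD) auto
    ultimately have "m \<le> G w" using m by (simp add: dist_norm norm_minus_commute)
    also have "G w \<le> (1 - 1/t) * G x0 + (1/t) * G y"
      unfolding w_def using convex_onD[OF convex_on_G, of "1/t" x0 y] t y assms by simp
    finally have "t * m \<le> t * ((1 - 1/t) * G x0 + (1/t) * G y)" using t by (intro mult_left_mono) auto
    also have "\<dots> = (t - 1) * G x0 + G y" using t by (simp add: field_simps)
    finally have "t * m - (t - 1) * G x0 \<le> G y" by simp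
    moreover have "t * m \<ge> - (t * \<bar>m\<bar>)" using t abs_ge_minus_self[of m] by (metis abs_ge_minus_self abs_mult abs_of_pos dual_order.strict_trans less_numeral_extra(1) minus_le_iff)
    moreover have "(t - 1) * G x0 \<le> (t - 1) * \<bar>G x0\<bar>" using t by (intro mult_left_mono) auto
    moreover have "(t - 1) * \<bar>G x0\<bar> \<le> (1 + t) * \<bar>G x0\<bar>" by (intro mult_right_mono) auto
    moreover have "\<kappa> * (1 + t) = \<bar>m\<bar> + t * \<bar>m\<bar> + (1 + t) * \<bar>G x0\<bar>" by (simp add: \<kappa>_def algebra_simps)
    ultimately have "- (\<kappa> * (1 + t)) \<le> G y" using abs_ge_zero[of m] by linarith
    then show ?thesis unfolding t_def by simp
  qed
  then show ?thesis by (intro exI[of _ \<kappa>]) (auto simp: \<kappa>_def)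
qed

text \<open>The linear lower bound loses against the quadratic term, so minimizing sequences are
  bounded, and closedness of the epigraph makes a cluster point a minimizer.\<close>

lemma proximal_minimizer_exists:
  assumes "D \<noteq> {}" "t > 0"
  shows "\<exists>x\<in>D. \<forall>y\<in>D. t * G x + 1/2 * (norm (x - w))\<^sup>2 \<le> t * G y + 1/2 * (norm (y - w))\<^sup>2"
proof -
  define f where "f y = t * G y + 1/2 * (norm (y - w))\<^sup>2" for y
  obtain x0 where x0: "x0 \<in> D" using assms by auto
  obtain \<kappa> where \<kappa>: "\<kappa> \<ge> 0" "\<And>y. y \<in> D \<Longrightarrow> - \<kappa> * (1 + norm (y - x0)) \<le> G y"
    using linear_lower_bound[OF x0] by blast
  define A where "A = t * \<kappa> * (1 + norm (w - x0))"
  define B where "B = t * \<kappa>"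
  have AB: "A \<ge> 0" "B \<ge> 0" using \<kappa> assms by (auto simp: A_def B_def)
  have low: "1/2 * (norm (y - w))\<^sup>2 - B * norm (y - w) - A \<le> f y" if "y \<in> D" for y
  proof -
    have "norm (y - x0) \<le> norm (y - w) + norm (w - x0)" by (rule order_trans[OF _ norm_triangle_ineq]) simp
    then have "\<kappa> * (1 + norm (y - x0)) \<le> \<kappa> * (1 + norm (w - x0) + norm (y - w))"
      using \<kappa> by (intro mult_left_mono) auto
    then have "- (\<kappa> * (1 + norm (w - x0) + norm (y - w))) \<le> G y" using \<kappa>(2)[OF that] by simp
    then have "t * - (\<kappa> * (1 + norm (w - x0) + norm (y - w))) \<le> t * G y"
      using assms by (intro mult_left_mono) auto
    then show ?thesis unfolding f_def A_def B_def by (simp add: algebra_simps)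
  qed
  have bdd: "bdd_below (f ` D)"
  proof (rule bdd_belowI2)
    fix y assume "y \<in> D"
    have "0 \<le> (norm (y - w) - B)\<^sup>2" by simp
    then have "- (B\<^sup>2 / 2) \<le> 1/2 * (norm (y - w))\<^sup>2 - B * norm (y - w)"
      by (simp add: power2_eq_square algebra_simps)
    then show "- (B\<^sup>2 / 2) - A \<le> f y" using low[OF \<open>y \<in> D\<close>] by simp
  qed
  define c where "c = Inf (f ` D)"
  have "\<exists>y\<in>D. f y < c + 1 / real (Suc n)" for n
  proof -
    have "Inf (f ` D) < c + 1 / real (Suc n)" unfolding c_def by simp
    then show ?thesis using cInf_lessD[of "f ` D"] x0 by blast
  qed
  then obtain X where X: "\<And>n. X n \<in> D" "\<And>n. f (X n) < c + 1 / real (Suc n)" by metis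
  have "norm (X n - w) \<le> 2 * B + 2 * (A + \<bar>c\<bar> + 1) + 1" for n
  proof (rule ccontr)
    define s where "s = norm (X n - w)"
    assume "\<not> ?thesis"
    then have s: "s > 2 * B + 2 * (A + \<bar>c\<bar> + 1) + 1" using s_def by simp
    have "1 / real (Suc n) \<le> 1" by simp
    then have "1/2 * s\<^sup>2 - B * s - A \<le> \<bar>c\<bar> + 1" using low[OF X(1)[of n]] X(2)[of n] unfolding s_def by linarith
    then have "s * s \<le> s * (2 * B) + 2 * (A + \<bar>c\<bar> + 1)" by (simp add: power2_eq_square algebra_simps)
    also have "\<dots> \<le> s * (2 * B) + s * (2 * (A + \<bar>c\<bar> + 1))"
    proof -
      have "1 * (2 * (A + \<bar>c\<bar> + 1)) \<le> s * (2 * (A + \<bar>c\<bar> + 1))"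
        using s AB by (intro mult_right_mono) auto
      then show ?thesis by simp
    qed
    also have "\<dots> = s * (2 * B + 2 * (A + \<bar>c\<bar> + 1))" by (simp add: algebra_simps)
    also have "\<dots> < s * s" using s AB by (intro mult_strict_left_mono) auto
    finally show False by simp
  qed
  then have "bounded (range X)"
    by (intro boundedI[of _ "norm w + (2 * B + 2 * (A + \<bar>c\<bar> + 1) + 1)"])
      (auto intro: order_trans[OF norm_triangle_sub add_left_mono])
  then obtain x r where r: "strict_mono (r :: nat \<Rightarrow> nat)" "(X \<circ> r) \<longlonglongrightarrow> x"
    using bounded_imp_convergent_subsequence by blast
  have "(\<lambda>n. 1 / real (Suc n)) \<longlonglongrightarrow> 0" using LIMSEQ_inverse_real_of_nat by (simp add: inverse_eq_divide)
  from LIMSEQ_subseq_LIMSEQ[OF this r(1)] have inv0: "(\<lambda>n. 1 / real (Suc (r n))) \<longlonglongrightarrow> 0"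
    by (simp add: o_def)
  \<comment> \<open>Near-minimality is solved for \<open>G\<close>: the quadratic term moves into
    the convergent upper bound that \<open>closed_epigraph\<close> asks for.\<close>
  have "(\<lambda>n. (c + 1 / real (Suc (r n)) - 1/2 * (norm ((X \<circ> r) n - w))\<^sup>2) / t) \<longlonglongrightarrow> (c + 0 - 1/2 * (norm (x - w))\<^sup>2) / t"
    using assms by (intro tendsto_intros inv0 r(2)) auto
  moreover have "G ((X \<circ> r) n) \<le> (c + 1 / real (Suc (r n)) - 1/2 * (norm ((X \<circ> r) n - w))\<^sup>2) / t" for n
    using X(2)[of "r n"] assms unfolding f_def by (simp add: pos_le_divide_eq algebra_simps)
  ultimately have "x \<in> D \<and> G x \<le> (c + 0 - 1/2 * (norm (x - w))\<^sup>2) / t"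
    by (intro closed_epigraph[OF _ r(2)]) (use X(1) in simp)
  then have "x \<in> D" "f x \<le> c" using assms unfolding f_def by (auto simp: pos_le_divide_eq algebra_simps)
  moreover have "c \<le> f y" if "y \<in> D" for y unfolding c_def using bdd that by (intro cInf_lower) auto
  ultimately show ?thesis unfolding f_def by (meson order_trans)
qed

text \<open>Moving from the minimizer a fraction \<open>s\<close> towards \<open>u\<close> would
  gain at least \<open>s * a\<close> and cost only a term of order \<open>s\<^sup>2\<close>, so a
  positive defect \<open>a\<close> contradicts minimality for small \<open>s\<close>.\<close>

lemma proximal_inequality:
  assumes x: "x \<in> D" and min: "\<And>y. y \<in> D \<Longrightarrow> t * G x + 1/2 * (norm (x - w))\<^sup>2 \<le> t * G y + 1/2 * (norm (y - w))\<^sup>2"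
    and t: "t > 0" and u: "u \<in> D"
  shows "t * (G x - G u) \<le> inner (x - w) (u - x)"
proof (rule ccontr)
  define a where "a = t * (G x - G u) - inner (x - w) (u - x)"
  assume "\<not> ?thesis"
  then have a: "a > 0" unfolding a_def by simp
  have *: "s * a \<le> s\<^sup>2 / 2 * (norm (u - x))\<^sup>2" if s: "0 < s" "s \<le> 1" for s
  proof -
    let ?y = "(1 - s) *\<^sub>R x + s *\<^sub>R u"
    have yD: "?y \<in> D" using s x u convex_D by (intro convexD) auto
    have "G ?y \<le> (1 - s) * G x + s * G u" using convex_on_G s x u by (auto simp: convex_on_def)
    then have "t * G ?y \<le> t * ((1 - s) * G x + s * G u)" using t by (intro mult_left_mono) auto
    moreover have "(norm (?y - w))\<^sup>2 = (norm (x - w))\<^sup>2 + 2 * s * inner (x - w) (u - x) + s\<^sup>2 * (norm (u - x))\<^sup>2"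
    proof -
      have "?y - w = (x - w) + s *\<^sub>R (u - x)" by (simp add: algebra_simps)
      then show ?thesis
        by (simp only: power2_norm_eq_inner) (simp add: inner_add_left inner_add_right inner_commute power2_eq_square)
    qed
    ultimately show ?thesis using min[OF yD] unfolding a_def by (simp add: algebra_simps)
  qed
  define N where "N = (norm (u - x))\<^sup>2"
  \<comment> \<open>The choice yields \<open>s * (N + 1) \<le> a\<close>, against
    \<open>a \<le> s / 2 * N\<close> from minimality.\<close>
  define s where "s = min 1 (a / (N + 1))"
  have N: "N \<ge> 0" unfolding N_def by simp
  have s: "0 < s" "s \<le> 1" using a N by (auto simp: s_def)
  have "s * (N + 1) \<le> a / (N + 1) * (N + 1)" unfolding s_def using N by (intro mult_right_mono) auto
  then have s3: "s * (N + 1) \<le> a" using N by simp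
  have "s * a \<le> s * (s / 2 * N)" using *[OF s(1,2)] unfolding N_def by (simp add: power2_eq_square)
  then have "a \<le> s / 2 * N" using s by simp
  moreover have "s / 2 * N \<le> s * N" using s N by (intro mult_right_mono) auto
  moreover have "s * N < s * (N + 1)" using s by simp
  ultimately show False using s3 by linarith
qed

end

section \<open>The energy of the golden ratio iteration\<close>

text \<open>The minimum in the step rule enters as three upper bounds together with
  \<open>lam_cases\<close>, by which one of them is attained, and the proximal step enters as its
  variational inequality. This keeps extended reals and the choice operator out of the
  analysis.\<close>

locale golden_ratio_iteration = closed_convex_function D G
  for D :: "'a::euclidean_space set" and G :: "'a \<Rightarrow> real" +
  fixes F :: "'a \<Rightarrow> 'a" and \<phi> lbar :: real and z zb :: "nat \<Rightarrow> 'a" and lam th :: "nat \<Rightarrow> real"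
    and zs :: 'a
  assumes F_mono: "u \<in> D \<Longrightarrow> v \<in> D \<Longrightarrow> 0 \<le> inner (F u - F v) (u - v)"
    and F_lipschitz: "x \<in> D \<Longrightarrow> \<exists>\<delta>>0. \<exists>L. L-lipschitz_on (cball x \<delta> \<inter> D) F"
    and zs_in: "zs \<in> D"
    and zs_solves: "u \<in> D \<Longrightarrow> 0 \<le> inner (F zs) (u - zs) + G u - G zs"
    and phi_gt: "1 < \<phi>" and phi_le: "\<phi>\<^sup>2 \<le> \<phi> + 1"
    and lam_pos: "0 < lam k"
    and lbar_pos: "0 < lbar"
    and lam_growth: "lam (Suc k) \<le> (1 / \<phi> + 1 / \<phi>\<^sup>2) * lam k"
    and lam_le_lbar: "lam (Suc k) \<le> lbar"
    and lam_local: "4 * lam (Suc k) * lam k * (norm (F (z (Suc k)) - F (z k)))\<^sup>2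
          \<le> \<phi> * th k * (norm (z (Suc k) - z k))\<^sup>2"
    and lam_cases: "lam (Suc k) = (1 / \<phi> + 1 / \<phi>\<^sup>2) * lam k \<or> lam (Suc k) = lbar \<or>
          (F (z (Suc k)) \<noteq> F (z k) \<and> 4 * lam (Suc k) * lam k * (norm (F (z (Suc k)) - F (z k)))\<^sup>2
            = \<phi> * th k * (norm (z (Suc k) - z k))\<^sup>2)"
    and th_Suc: "th (Suc k) = \<phi> * lam (Suc k) / lam k"
    and zb_0: "zb 0 = z (Suc 0)"
    and zb_Suc: "zb (Suc k) = ((\<phi> - 1) *\<^sub>R z (Suc k) + zb k) /\<^sub>R \<phi>"
    and z_in: "z (Suc k) \<in> D"
    and z_prox: "u \<in> D \<Longrightarrow> lam (Suc k) * (G (z (Suc (Suc k))) - G u)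
      \<le> inner (z (Suc (Suc k)) - zb (Suc k) + lam (Suc k) *\<^sub>R F (z (Suc k))) (u - z (Suc (Suc k)))"
begin

text \<open>The term under the supremum of \<open>restricted_gap\<close>. It is convex in
  \<open>x\<close>, and nonnegative on \<open>D\<close> if \<open>p\<close> solves the variational
  inequality.\<close>

definition gap :: "'a \<Rightarrow> 'a \<Rightarrow> real"
  where "gap p x = inner (F p) (x - p) + G x - G p"

text \<open>The indices are shifted by one against the usual \<open>\<phi>/(\<phi>-1) |zb\<^sup>k - p|\<^sup>2 + \<theta>\<^sub>k\<^sub>-\<^sub>1/2 |z\<^sup>k - z\<^sup>k\<^sup>-\<^sup>1|\<^sup>2\<close>,
  to avoid subtraction on the natural numbers.\<close>
definition energy :: "'a \<Rightarrow> nat \<Rightarrow> real"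
  where "energy p k = \<phi> / (\<phi> - 1) * (norm (zb (Suc k) - p))\<^sup>2
    + th k / 2 * (norm (z (Suc k) - z k))\<^sup>2"

section \<open>Identities of the averaging step and the energy inequality\<close>

lemma th_pos: "0 < th (Suc k)"
  using lam_pos phi_gt by (simp add: th_Suc)

text \<open>The growth factor of the steps is exactly the one that keeps
  \<open>1 + 1 / \<phi> - th\<close> nonnegative, which is a weight in
  \<open>energy_decrease\<close>.\<close>

lemma th_le: "th (Suc k) \<le> 1 + 1 / \<phi>"
proof -
  have "\<phi> * lam (Suc k) \<le> \<phi> * ((1 / \<phi> + 1 / \<phi>\<^sup>2) * lam k)"
    using phi_gt lam_growth by (intro mult_left_mono) auto
  also have "\<dots> = (1 + 1 / \<phi>) * lam k" using phi_gt by (simp add: field_simps power2_eq_square)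
  finally show ?thesis using lam_pos[of k] by (simp add: th_Suc pos_divide_le_eq)
qed

text \<open>The golden ratio bound on \<open>\<phi>\<close> enters here: the first entry of the step
  minimum never forces the step to shrink.\<close>

lemma rho_ge_1: "1 \<le> 1 / \<phi> + 1 / \<phi>\<^sup>2"
  using phi_gt phi_le by (simp add: field_simps power2_eq_square)

lemma zb_in: "zb k \<in> D"
proof (induction k)
  case 0 then show ?case using z_in by (simp add: zb_0)
next
  case (Suc k)
  have "zb (Suc k) = (1 - 1 / \<phi>) *\<^sub>R z (Suc k) + (1 / \<phi>) *\<^sub>R zb k"
    using phi_gt by (simp add: zb_Suc scaleR_add_right divide_inverse algebra_simps)
  then show ?case using convexD[OF convex_D z_in Suc, of "1 - 1/\<phi>" "1/\<phi>"] phi_gt by auto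
qed

lemma z_minus_zb: "z (Suc k) - zb (Suc k) = (z (Suc k) - zb k) /\<^sub>R \<phi>"
proof -
  have "\<phi> *\<^sub>R (z (Suc k) - zb (Suc k)) = z (Suc k) - zb k"
    using phi_gt by (simp add: zb_Suc algebra_simps)
  then show ?thesis using phi_gt by (metis scaleR_scaleR left_inverse less_numeral_extra(1) not_less_iff_gr_or_eq order_less_trans scaleR_one zero_less_one)
qed

lemma zb_step: "zb (Suc k) - zb k = ((\<phi> - 1) / \<phi>) *\<^sub>R (z (Suc k) - zb k)"
proof -
  have "zb (Suc k) - zb k = (z (Suc k) - zb k) - (z (Suc k) - zb (Suc k))" by simp
  also have "\<dots> = (1 - inverse \<phi>) *\<^sub>R (z (Suc k) - zb k)"
    unfolding z_minus_zb by (simp only: scaleR_left_diff_distrib scaleR_one)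
  also have "1 - inverse \<phi> = (\<phi> - 1) / \<phi>" using phi_gt by (simp add: field_simps)
  finally show ?thesis .
qed

text \<open>The squared norm of the convex combination \<open>zb (Suc k) - p\<close> with weights
  \<open>1 - 1 / \<phi>\<close> and \<open>1 / \<phi>\<close>, solved for the term of the iterate.
  It is the origin of the factor \<open>\<phi> / (\<phi> - 1)\<close> in the energy and of the
  summand \<open>1 / \<phi>\<close> in the dissipation.\<close>

lemma prox_step_norm:
  "(norm (z (Suc k) - p))\<^sup>2 = \<phi> / (\<phi> - 1) * (norm (zb (Suc k) - p))\<^sup>2
    - 1 / (\<phi> - 1) * (norm (zb k - p))\<^sup>2 + 1 / \<phi> * (norm (z (Suc k) - zb k))\<^sup>2"
proof -
  define X where "X = z (Suc k) - p"
  define Y where "Y = zb k - p"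
  define Q where "Q = \<phi> - 1"
  have Q: "Q > 0" "\<phi> = Q + 1" using phi_gt by (auto simp: Q_def)
  have "\<phi> *\<^sub>R (zb (Suc k) - p) = Q *\<^sub>R X + Y"
    using phi_gt unfolding X_def Y_def Q_def zb_Suc by (simp add: algebra_simps)
  then have "(norm (\<phi> *\<^sub>R (zb (Suc k) - p)))\<^sup>2 = (norm (Q *\<^sub>R X + Y))\<^sup>2" by simp
  also have "\<dots> = Q\<^sup>2 * (norm X)\<^sup>2 + 2 * Q * inner X Y + (norm Y)\<^sup>2"
    by (simp only: power2_norm_eq_inner)
      (simp add: inner_add_left inner_add_right inner_commute power2_eq_square)
  finally have 1: "\<phi>\<^sup>2 * (norm (zb (Suc k) - p))\<^sup>2 = Q\<^sup>2 * (norm X)\<^sup>2 + 2 * Q * inner X Y + (norm Y)\<^sup>2"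
    by (simp add: power_mult_distrib)
  have "z (Suc k) - zb k = X - Y" by (simp add: X_def Y_def)
  then have 2: "(norm (z (Suc k) - zb k))\<^sup>2 = (norm X)\<^sup>2 - 2 * inner X Y + (norm Y)\<^sup>2"
    by (simp only: power2_norm_eq_inner) (simp add: inner_diff_left inner_diff_right inner_commute)
  define R where "R = \<phi> / Q * (norm (zb (Suc k) - p))\<^sup>2 - 1 / Q * (norm Y)\<^sup>2
    + 1 / \<phi> * ((norm X)\<^sup>2 - 2 * inner X Y + (norm Y)\<^sup>2)"
  have "Q * \<phi> * R = \<phi>\<^sup>2 * (norm (zb (Suc k) - p))\<^sup>2 - \<phi> * (norm Y)\<^sup>2
    + Q * ((norm X)\<^sup>2 - 2 * inner X Y + (norm Y)\<^sup>2)"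
    using Q(1) phi_gt unfolding R_def by (simp add: distrib_left right_diff_distrib power2_eq_square)
  also have "\<dots> = Q * \<phi> * (norm X)\<^sup>2"
    unfolding 1 unfolding Q(2) by (simp add: algebra_simps power2_eq_square)
  finally have "(norm X)\<^sup>2 = R" using Q(1) phi_gt by simp
  then show ?thesis unfolding R_def 2 X_def[symmetric] Y_def[symmetric] Q_def[symmetric] .
qed

text \<open>Two proximal inequalities are added: that of the new iterate \<open>a\<close>, tested at
  \<open>p\<close>, and that of its predecessor \<open>b\<close>, tested at \<open>a\<close>. The
  second is scaled by \<open>l / l'\<close> so that \<open>G a\<close> cancels, and since
  \<open>b - zb m = \<phi> *\<^sub>R (b - c)\<close>, the scaling produces exactly the factor
  \<open>th\<close>.\<close>

lemma energy_decrease: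
  assumes p: "p \<in> D"
  shows "energy p (Suc (Suc k)) + 2 * lam (Suc (Suc k)) * gap p (z (Suc (Suc k)))
      + th (Suc (Suc k)) * (norm (z (Suc (Suc k)) - zb (Suc (Suc k))))\<^sup>2
      + (1 + 1 / \<phi> - th (Suc (Suc k))) * (norm (z (Suc (Suc (Suc k))) - zb (Suc (Suc k))))\<^sup>2
    \<le> energy p (Suc k)"
proof -
  define m where "m = Suc k"
  define a b b' c where "a = z (Suc (Suc m))" and "b = z (Suc m)" and "b' = z m" and "c = zb (Suc m)"
  define l l' t t' where "l = lam (Suc m)" and "l' = lam m" and "t = th (Suc m)" and "t' = th m"
  note defs = a_def b_def b'_def c_def l_def l'_def t_def t'_def m_def
  have pos: "l > 0" "l' > 0" "t > 0" "t' > 0" using lam_pos th_pos by (auto simp: defs)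
  have 1: "l * (G a - G p) \<le> inner (a - c + l *\<^sub>R F b) (p - a)"
    using z_prox[OF p, of m] by (simp add: defs)
  have aD: "a \<in> D" "b \<in> D" using z_in by (auto simp: defs)
  have "l' * (G b - G a) \<le> inner (b - zb m + l' *\<^sub>R F b') (a - b)"
    using z_prox[OF aD(1), of k] by (simp add: defs)
  then have "(l / l') * (l' * (G b - G a)) \<le> (l / l') * inner (b - zb m + l' *\<^sub>R F b') (a - b)"
    using pos by (intro mult_left_mono) auto
  moreover have "b - zb m = \<phi> *\<^sub>R (b - c)" using z_minus_zb[of m] phi_gt by (simp add: defs)
  moreover have t: "t = \<phi> * l / l'" by (simp add: defs th_Suc)
  moreover have "(l / l') * inner (\<phi> *\<^sub>R (b - c) + l' *\<^sub>R F b') (a - b)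
      = (\<phi> * l / l') * inner (b - c) (a - b) + l * inner (F b') (a - b)"
    using pos by (simp add: inner_add_left distrib_left)
  ultimately have 2: "l * (G b - G a) \<le> t * inner (b - c) (a - b) + l * inner (F b') (a - b)"
    using pos by simp
  \<comment> \<open>Monotonicity trades \<open>F b\<close> for \<open>F p\<close>. The difference
    \<open>F b - F b'\<close> survives because the second inequality contains the operator value at
    \<open>b'\<close>.\<close>
  have "inner (F p) (b - p) \<le> inner (F b) (b - p)"
    using F_mono[OF aD(2) p] by (simp add: inner_diff_left)
  then have "l * inner (F p) (b - p) \<le> l * inner (F b) (b - p)" using pos by simp
  with 1 2 have 3: "l * gap p b \<le> inner (a - c) (p - a) + t * inner (b - c) (a - b) + l * inner (F b - F b') (b - a)"
    unfolding gap_def by (simp add: inner_add_left inner_diff_left inner_diff_right algebra_simps)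
  have 4: "2 * inner (a - c) (p - a) = (norm (c - p))\<^sup>2 - (norm (a - c))\<^sup>2 - (norm (a - p))\<^sup>2"
    by (simp only: power2_norm_eq_inner) (simp add: inner_diff_left inner_diff_right inner_commute)
  have 5: "2 * inner (b - c) (a - b) = (norm (a - c))\<^sup>2 - (norm (b - c))\<^sup>2 - (norm (a - b))\<^sup>2"
    by (simp only: power2_norm_eq_inner) (simp add: inner_diff_left inner_diff_right inner_commute)
  \<comment> \<open>Scaled by \<open>l / l'\<close>, the local step rule bounds
    \<open>(2 * l * N)\<^sup>2\<close> by \<open>t * t'\<close> times the squared step. The factor 4
    in the rule makes the halves fit: \<open>t' / 2\<close> is the weight in the old energy, and
    \<open>t / 2\<close> takes half of the negative term in \<open>5\<close>, whose other half is
    the weight in the new energy.\<close>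
  have 6: "2 * l * inner (F b - F b') (b - a) \<le> t / 2 * (norm (a - b))\<^sup>2 + t' / 2 * (norm (b - b'))\<^sup>2"
  proof -
    define N where "N = norm (F b - F b')"
    have "4 * l * l' * N\<^sup>2 \<le> \<phi> * t' * (norm (b - b'))\<^sup>2"
      using lam_local[of m] by (simp add: defs N_def)
    then have "(l / l') * (4 * l * l' * N\<^sup>2) \<le> (l / l') * (\<phi> * t' * (norm (b - b'))\<^sup>2)"
      using pos by (intro mult_left_mono) auto
    moreover have "(l / l') * (4 * l * l' * N\<^sup>2) = (2 * l * N)\<^sup>2"
      using pos by (simp add: power2_eq_square)
    moreover have "(l / l') * (\<phi> * t' * (norm (b - b'))\<^sup>2) = t * t' * (norm (b - b'))\<^sup>2"
      unfolding t by simp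
    ultimately have N: "(2 * l * N)\<^sup>2 \<le> t * t' * (norm (b - b'))\<^sup>2" by simp
    have "2 * l * N \<le> sqrt (t * t' * (norm (b - b'))\<^sup>2)" using N by (rule real_le_rsqrt)
    then have "2 * l * N \<le> sqrt t * sqrt t' * norm (b - b')" by (simp add: real_sqrt_mult)
    have "2 * l * inner (F b - F b') (b - a) \<le> 2 * l * (N * norm (a - b))"
      using pos norm_cauchy_schwarz[of "F b - F b'" "b - a"] unfolding N_def
      by (simp add: norm_minus_commute)
    also have "\<dots> = (2 * l * N) * norm (a - b)" by simp
    also have "\<dots> \<le> (sqrt t * sqrt t' * norm (b - b')) * norm (a - b)"
      using \<open>2 * l * N \<le> sqrt t * sqrt t' * norm (b - b')\<close> by (intro mult_right_mono) auto
    also have "\<dots> \<le> ((sqrt t * norm (a - b))\<^sup>2 + (sqrt t' * norm (b - b'))\<^sup>2) / 2"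
      using sum_squares_bound[of "sqrt t * norm (a - b)" "sqrt t' * norm (b - b')"]
      by (simp add: algebra_simps)
    also have "\<dots> = t / 2 * (norm (a - b))\<^sup>2 + t' / 2 * (norm (b - b'))\<^sup>2"
      using pos by (simp add: power_mult_distrib add_divide_distrib)
    finally show ?thesis .
  qed
  have 7: "(norm (a - p))\<^sup>2 = \<phi> / (\<phi> - 1) * (norm (zb (Suc (Suc m)) - p))\<^sup>2
    - 1 / (\<phi> - 1) * (norm (c - p))\<^sup>2 + 1 / \<phi> * (norm (a - c))\<^sup>2"
    using prox_step_norm[of "Suc m" p] by (simp add: defs)
  have 8: "\<phi> / (\<phi> - 1) * (norm (c - p))\<^sup>2 = (norm (c - p))\<^sup>2 + 1 / (\<phi> - 1) * (norm (c - p))\<^sup>2"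
    using phi_gt by (simp add: field_simps)
  define u where "u = t * inner (b - c) (a - b)"
  have u: "2 * u = t * (norm (a - c))\<^sup>2 - t * (norm (b - c))\<^sup>2 - t * (norm (a - b))\<^sup>2"
    unfolding u_def using arg_cong[OF 5, of "\<lambda>x. t * x"] by (simp add: algebra_simps)
  \<comment> \<open>The weight of the squared norm of \<open>a - c\<close> collects 1 from
    \<open>4\<close>, \<open>1 / \<phi>\<close> from \<open>7\<close> and \<open>- t\<close> from
    \<open>5\<close>.\<close>
  have "2 * l * gap p b \<le> 2 * inner (a - c) (p - a) + 2 * u + 2 * l * inner (F b - F b') (b - a)"
    using 3 unfolding u_def by simp
  then have "\<phi> / (\<phi> - 1) * (norm (zb (Suc (Suc m)) - p))\<^sup>2 + t / 2 * (norm (a - b))\<^sup>2 + 2 * l * gap p b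
      + t * (norm (b - c))\<^sup>2 + (1 + 1 / \<phi> - t) * (norm (a - c))\<^sup>2
    \<le> \<phi> / (\<phi> - 1) * (norm (c - p))\<^sup>2 + t' / 2 * (norm (b - b'))\<^sup>2"
    using 4 6 7 8 u unfolding ring_distribs by linarith
  then show ?thesis unfolding energy_def by (simp add: defs)
qed

section \<open>Boundedness of the iterates and vanishing displacements\<close>

lemma energy_nonneg: "0 \<le> energy p (Suc k)"
  using phi_gt th_pos[of k] unfolding energy_def by simp

lemma energy_ge: "(norm (zb (Suc (Suc k)) - p))\<^sup>2 \<le> energy p (Suc k)"
proof -
  have "1 * (norm (zb (Suc (Suc k)) - p))\<^sup>2 \<le> \<phi> / (\<phi> - 1) * (norm (zb (Suc (Suc k)) - p))\<^sup>2"
    using phi_gt by (intro mult_right_mono) auto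
  moreover have "0 \<le> th (Suc k) / 2 * (norm (z (Suc (Suc k)) - z (Suc k)))\<^sup>2" using th_pos[of k] by simp
  ultimately show ?thesis unfolding energy_def by linarith
qed

lemma energy_gap_decrease:
  assumes p: "p \<in> D"
  shows "energy p (Suc (Suc k)) + 2 * lam (Suc (Suc k)) * gap p (z (Suc (Suc k))) \<le> energy p (Suc k)"
proof -
  have "0 \<le> th (Suc (Suc k)) * (norm (z (Suc (Suc k)) - zb (Suc (Suc k))))\<^sup>2"
    using th_pos[of "Suc k"] by simp
  moreover have "0 \<le> (1 + 1 / \<phi> - th (Suc (Suc k))) * (norm (z (Suc (Suc (Suc k))) - zb (Suc (Suc k))))\<^sup>2"
    using th_le[of "Suc k"] by (intro mult_nonneg_nonneg) auto
  ultimately show ?thesis using energy_decrease[OF p, of k] by linarith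
qed

lemma sum_gap_le:
  assumes p: "p \<in> D"
  shows "(\<Sum>i<n. 2 * lam (Suc (Suc i)) * gap p (z (Suc (Suc i)))) \<le> energy p (Suc 0) - energy p (Suc n)"
proof (induction n)
  case (Suc n)
  then show ?case using energy_gap_decrease[OF p, of n] by simp
qed simp

lemma gap_zs_nonneg: "x \<in> D \<Longrightarrow> 0 \<le> gap zs x"
  using zs_solves unfolding gap_def by auto

lemma energy_zs_decseq: "energy zs (Suc (Suc k)) \<le> energy zs (Suc k)"
proof -
  have "0 \<le> 2 * lam (Suc (Suc k)) * gap zs (z (Suc (Suc k)))"
    using gap_zs_nonneg[OF z_in] lam_pos[of "Suc (Suc k)"] by simp
  then show ?thesis using energy_gap_decrease[OF zs_in, of k] by linarith
qed

text \<open>The energy at the solution bounds \<open>zb\<close> from index 2 on, and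
  \<open>z\<close> is recovered from two consecutive averages by solving \<open>zb_step\<close> for
  \<open>z (Suc k)\<close>.\<close>

lemma bounded_iterates: "\<exists>R. \<forall>k. norm (z k) \<le> R \<and> norm (zb k) \<le> R"
proof -
  have "energy zs (Suc k) \<le> energy zs (Suc 0)" for k
  proof (induction k)
    case (Suc k)
    then show ?case using energy_zs_decseq[of k] by linarith
  qed simp
  then have "norm (zb (Suc (Suc k)) - zs) \<le> sqrt (energy zs (Suc 0))" for k
    using energy_ge by (meson order_trans real_le_rsqrt)
  then have shifted: "norm (zb (Suc (Suc k))) \<le> norm zs + sqrt (energy zs (Suc 0))" for k
    using norm_triangle_sub[of "zb (Suc (Suc k))" zs] by (meson add_left_mono order_trans)
  define B where "B = max (norm (zb 0)) (max (norm (zb (Suc 0))) (norm zs + sqrt (energy zs (Suc 0))))"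
  have B: "norm (zb k) \<le> B" for k
  proof -
    consider "k = 0" | "k = Suc 0" | j where "k = Suc (Suc j)" by (metis not0_implies_Suc)
    then show ?thesis unfolding B_def using shifted by cases (simp_all add: le_max_iff_disj)
  qed
  define c where "c = \<phi> / (\<phi> - 1)"
  have c: "c > 0" using phi_gt by (simp add: c_def)
  have "norm (z (Suc k)) \<le> B + c * (2 * B)" for k
  proof -
    have "z (Suc k) = zb k + c *\<^sub>R (zb (Suc k) - zb k)" unfolding zb_step using phi_gt by (simp add: c_def)
    also have "norm \<dots> \<le> norm (zb k) + c * norm (zb (Suc k) - zb k)"
      using c by (intro order_trans[OF norm_triangle_ineq]) simp
    also have "\<dots> \<le> B + c * (2 * B)"
      using c B[of k] B[of "Suc k"] norm_triangle_ineq4[of "zb (Suc k)" "zb k"]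
      by (intro add_mono mult_left_mono) auto
    finally show ?thesis .
  qed
  then have "norm (z k) \<le> max (norm (z 0)) (B + c * (2 * B))" for k
    by (cases k) (auto simp: le_max_iff_disj)
  then show ?thesis using B
    by (intro exI[of _ "max B (max (norm (z 0)) (B + c * (2 * B)))"]) (auto simp: le_max_iff_disj)
qed

text \<open>An energy drop controls \<open>th * y\<^sup>2\<close> and
  \<open>(c0 - th) * x\<^sup>2\<close>, two weights with constant sum \<open>c0\<close>. If
  \<open>th\<close> falls from large to small between two steps, neither weight controls
  \<open>x K\<close>. Then the drop itself is solved for the step length \<open>e\<close>, which it
  contains with the large weight \<open>th K / 2\<close>; the square root stems from the difference
  of squared distances from \<open>zs\<close>.\<close>

lemma prox_displacement_bound:
  assumes R: "\<And>k. norm (zb k) \<le> R"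
    and d: "\<And>k. \<delta> k = energy zs (Suc k) - energy zs (Suc (Suc k))"
  defines "c0 \<equiv> 1 + 1 / \<phi>"
  shows "(norm (z (Suc (Suc (Suc k))) - zb (Suc (Suc k))))\<^sup>2 \<le>
    2 * \<phi>\<^sup>2 / c0 * \<delta> (Suc k) + 6 / c0 * \<delta> k
    + 8 / c0 * (4 * \<delta> (Suc k) + 2 * (R + norm zs) * sqrt (2 / c0 * \<delta> (Suc k)))"
proof -
  define K where "K = Suc (Suc k)"
  have c0: "c0 > 0" using phi_gt unfolding c0_def by (simp add: add_pos_pos)
  have R0: "R + norm zs \<ge> 0" using R[of 0] norm_ge_zero[of "zb 0"] norm_ge_zero[of zs] by linarith
  have d0: "\<delta> n \<ge> 0" for n using energy_zs_decseq[of n] by (simp add: d)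
  have tK: "th K > 0" "th (Suc K) > 0" "th K \<le> c0" "th (Suc K) \<le> c0" using th_pos th_le by (auto simp: K_def c0_def)
  have diss: "th (Suc (Suc n)) * (norm (z (Suc (Suc n)) - zb (Suc (Suc n))))\<^sup>2
      + (c0 - th (Suc (Suc n))) * (norm (z (Suc (Suc (Suc n))) - zb (Suc (Suc n))))\<^sup>2 \<le> \<delta> n" for n
  proof -
    have "0 \<le> 2 * lam (Suc (Suc n)) * gap zs (z (Suc (Suc n)))"
      using gap_zs_nonneg[OF z_in] lam_pos[of "Suc (Suc n)"] by simp
    then show ?thesis using energy_decrease[OF zs_in, of n] unfolding d c0_def by linarith
  qed
  have nn: "0 \<le> th (Suc (Suc n)) * (norm (z (Suc (Suc n)) - zb (Suc (Suc n))))\<^sup>2"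
     "0 \<le> (c0 - th (Suc (Suc n))) * (norm (z (Suc (Suc (Suc n))) - zb (Suc (Suc n))))\<^sup>2" for n
    using th_pos[of "Suc n"] th_le[of "Suc n"] unfolding c0_def by (auto intro!: mult_nonneg_nonneg)
  define x where "x n = norm (z (Suc n) - zb n)" for n
  define y where "y n = norm (z n - zb n)" for n
  have y: "y (Suc n) = x n / \<phi>" for n
    using phi_gt unfolding x_def y_def z_minus_zb by (simp add: divide_inverse)
  have A: "th K * (y K)\<^sup>2 \<le> \<delta> k" "th (Suc K) * (y (Suc K))\<^sup>2 \<le> \<delta> (Suc k)"
    "(c0 - th K) * (x K)\<^sup>2 \<le> \<delta> k" "(c0 - th (Suc K)) * (x (Suc K))\<^sup>2 \<le> \<delta> (Suc k)"
    using diss[of k] nn[of k] diss[of "Suc k"] nn[of "Suc k"] unfolding x_def y_def K_def by linarith+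
  have half: "v \<le> 2 / c0 * e" if "t * v \<le> e" "t \<ge> c0 / 2" "v \<ge> 0" for t v e :: real
  proof -
    have "c0 / 2 * v \<le> t * v" using that by (intro mult_right_mono) auto
    then have "c0 / 2 * v \<le> e" using that by simp
    then show ?thesis using c0 by (simp add: field_simps)
  qed
  define P1 where "P1 = 2 * \<phi>\<^sup>2 / c0 * \<delta> (Suc k)"
  define P2 where "P2 = 8 / c0 * (4 * \<delta> (Suc k) + 2 * (R + norm zs) * sqrt (2 / c0 * \<delta> (Suc k)))"
  define P3 where "P3 = 2 / c0 * \<delta> k"
  have P: "P1 \<ge> 0" "P2 \<ge> 0" "P3 \<ge> 0" unfolding P1_def P2_def P3_def using c0 R0 d0 by auto
  \<comment> \<open>In the first case \<open>x K\<close> is read off from \<open>y (Suc K)\<close>,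
    in the second from its own weight at \<open>K\<close>; the third is the unfavourable
    switch.\<close>
  consider "th (Suc K) \<ge> c0 / 2" | "th K \<le> c0 / 2" | "th (Suc K) < c0 / 2" "th K > c0 / 2" by linarith
  then have "(x K)\<^sup>2 \<le> P1 + 3 * P3 + P2"
  proof cases
    case 1
    have "(x K / \<phi>)\<^sup>2 \<le> 2 / c0 * \<delta> (Suc k)" using half[OF A(2) 1] by (simp add: y)
    then have "\<phi>\<^sup>2 * (x K / \<phi>)\<^sup>2 \<le> \<phi>\<^sup>2 * (2 / c0 * \<delta> (Suc k))" by (intro mult_left_mono) auto
    then have "(x K)\<^sup>2 \<le> P1" using phi_gt unfolding P1_def by (simp add: power_divide algebra_simps)
    then show ?thesis using P by linarith
  next
    case 2
    have "(x K)\<^sup>2 \<le> P3" unfolding P3_def using 2 by (intro half[OF A(3)]) auto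
    then show ?thesis using P by linarith
  next
    case 3
    define e where "e = norm (z (Suc K) - z K)"
    define e' where "e' = norm (z (Suc (Suc K)) - z (Suc K))"
    have yK: "(y K)\<^sup>2 \<le> P3" unfolding P3_def using 3 by (intro half[OF A(1)]) auto
    have xS: "(x (Suc K))\<^sup>2 \<le> 2 / c0 * \<delta> (Suc k)" using 3 by (intro half[OF A(4)]) auto
    then have xS': "x (Suc K) \<le> sqrt (2 / c0 * \<delta> (Suc k))" by (rule real_le_rsqrt)
    have "e' \<le> x (Suc K) + y (Suc K)"
      unfolding e'_def x_def y_def using norm_triangle_ineq4[of "z (Suc (Suc K)) - zb (Suc K)" "z (Suc K) - zb (Suc K)"] by simp
    then have "e'\<^sup>2 \<le> (x (Suc K) + y (Suc K))\<^sup>2" unfolding e'_def by (intro power_mono) auto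
    also have "\<dots> \<le> 2 * (x (Suc K))\<^sup>2 + 2 * (y (Suc K))\<^sup>2"
      using sum_squares_bound[of "x (Suc K)" "y (Suc K)"] by (simp add: power2_sum)
    finally have "th (Suc K) / 2 * e'\<^sup>2 \<le> th (Suc K) / 2 * (2 * (x (Suc K))\<^sup>2 + 2 * (y (Suc K))\<^sup>2)"
      using tK by (intro mult_left_mono) auto
    also have "\<dots> = th (Suc K) * (x (Suc K))\<^sup>2 + th (Suc K) * (y (Suc K))\<^sup>2" by (simp add: algebra_simps)
    also have "\<dots> \<le> c0 * (2 / c0 * \<delta> (Suc k)) + \<delta> (Suc k)"
      using A(2) tK c0 xS by (intro add_mono mult_mono) auto
    finally have e': "th (Suc K) / 2 * e'\<^sup>2 \<le> 3 * \<delta> (Suc k)" using c0 by simp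
    \<comment> \<open>The distances from \<open>zs\<close> differ by at most the displacement of
      \<open>zb\<close>, a multiple of \<open>x (Suc K)\<close>; multiplication by the bounded sum
      \<open>p + q\<close> gives the difference of squares in the energy.\<close>
    define p q where "p = norm (zb (Suc (Suc K)) - zs)" and "q = norm (zb (Suc K) - zs)"
    have pq: "p + q \<le> 2 * (R + norm zs)" "p + q \<ge> 0" unfolding p_def q_def
      using R[of "Suc (Suc K)"] R[of "Suc K"] norm_triangle_ineq4[of "zb (Suc (Suc K))" zs] norm_triangle_ineq4[of "zb (Suc K)" zs]
      by simp_all
    have "p - q \<le> norm (zb (Suc (Suc K)) - zb (Suc K))"
      unfolding p_def q_def using norm_triangle_ineq2[of "zb (Suc (Suc K)) - zs" "zb (Suc K) - zs"] by simp
    also have "\<dots> = (\<phi> - 1) / \<phi> * x (Suc K)" unfolding zb_step x_def using phi_gt by simp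
    finally have "\<phi> / (\<phi> - 1) * (p - q) \<le> \<phi> / (\<phi> - 1) * ((\<phi> - 1) / \<phi> * x (Suc K))"
      using phi_gt by (intro mult_left_mono) auto
    then have "\<phi> / (\<phi> - 1) * (p - q) \<le> x (Suc K)" using phi_gt by simp
    also note xS'
    finally have "(p + q) * (\<phi> / (\<phi> - 1) * (p - q)) \<le> (p + q) * sqrt (2 / c0 * \<delta> (Suc k))"
      using pq by (intro mult_left_mono) auto
    also have "\<dots> \<le> 2 * (R + norm zs) * sqrt (2 / c0 * \<delta> (Suc k))"
      using pq c0 d0 by (intro mult_right_mono) auto
    finally have "\<phi> / (\<phi> - 1) * p\<^sup>2 - \<phi> / (\<phi> - 1) * q\<^sup>2 \<le> 2 * (R + norm zs) * sqrt (2 / c0 * \<delta> (Suc k))"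
      by (simp add: power2_eq_square algebra_simps diff_divide_distrib add_divide_distrib)
    moreover have "\<delta> (Suc k) = (\<phi> / (\<phi> - 1) * q\<^sup>2 + th K / 2 * e\<^sup>2) - (\<phi> / (\<phi> - 1) * p\<^sup>2 + th (Suc K) / 2 * e'\<^sup>2)"
      unfolding d energy_def p_def q_def e_def e'_def K_def ..
    ultimately have "th K / 2 * e\<^sup>2 \<le> 4 * \<delta> (Suc k) + 2 * (R + norm zs) * sqrt (2 / c0 * \<delta> (Suc k))"
      using e' by linarith
    then have "th K * e\<^sup>2 \<le> 2 * (4 * \<delta> (Suc k) + 2 * (R + norm zs) * sqrt (2 / c0 * \<delta> (Suc k)))" by simp
    then have "e\<^sup>2 \<le> 2 / c0 * (2 * (4 * \<delta> (Suc k) + 2 * (R + norm zs) * sqrt (2 / c0 * \<delta> (Suc k))))"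
      using 3 by (intro half) auto
    then have "2 * e\<^sup>2 \<le> 2 * (2 / c0 * (2 * (4 * \<delta> (Suc k) + 2 * (R + norm zs) * sqrt (2 / c0 * \<delta> (Suc k)))))"
      by (intro mult_left_mono) auto
    also have "\<dots> = P2" unfolding P2_def by (simp add: mult.assoc[symmetric])
    finally have e: "2 * e\<^sup>2 \<le> P2" .
    have "x K \<le> e + y K"
      unfolding e_def x_def y_def using norm_triangle_ineq[of "z (Suc K) - z K" "z K - zb K"] by simp
    then have "(x K)\<^sup>2 \<le> (e + y K)\<^sup>2" unfolding x_def by (intro power_mono) auto
    also have "\<dots> \<le> 2 * e\<^sup>2 + 2 * (y K)\<^sup>2"
      using sum_squares_bound[of "e" "y K"] by (simp add: power2_sum)
    finally show ?thesis using e yK P by linarith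
  qed
  then show ?thesis unfolding x_def K_def P1_def P2_def P3_def by simp
qed

lemma prox_displacement_vanishes: "(\<lambda>k. z (Suc k) - zb k) \<longlonglongrightarrow> 0"
proof -
  obtain R where R: "\<And>k. norm (zb k) \<le> R" using bounded_iterates by blast
  define \<delta> where "\<delta> k = energy zs (Suc k) - energy zs (Suc (Suc k))" for k
  have dec: "decseq (\<lambda>k. energy zs (Suc k))" by (intro decseq_SucI energy_zs_decseq)
  obtain L where L: "(\<lambda>k. energy zs (Suc k)) \<longlonglongrightarrow> L"
    using decseq_convergent[OF dec, of 0] energy_nonneg by metis
  have d0: "\<delta> \<longlonglongrightarrow> 0"
    using tendsto_diff[OF L LIMSEQ_Suc[OF L]] unfolding \<delta>_def by simp
  note d1 = LIMSEQ_Suc[OF d0]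
  have sqrt0: "(\<lambda>k. sqrt (2 / (1 + 1 / \<phi>) * \<delta> (Suc k))) \<longlonglongrightarrow> 0"
    using tendsto_real_sqrt[OF tendsto_mult_left[OF d1, of "2 / (1 + 1 / \<phi>)"]] by simp
  have "(\<lambda>k. 2 * \<phi>\<^sup>2 / (1 + 1 / \<phi>) * \<delta> (Suc k) + 6 / (1 + 1 / \<phi>) * \<delta> k + 8 / (1 + 1 / \<phi>)
      * (4 * \<delta> (Suc k) + 2 * (R + norm zs) * sqrt (2 / (1 + 1 / \<phi>) * \<delta> (Suc k)))) \<longlonglongrightarrow>
      2 * \<phi>\<^sup>2 / (1 + 1 / \<phi>) * 0 + 6 / (1 + 1 / \<phi>) * 0 + 8 / (1 + 1 / \<phi>) * (4 * 0 + 2 * (R + norm zs) * 0)"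
    by (intro tendsto_add tendsto_mult_left d0 d1 sqrt0)
  then have lim: "(\<lambda>k. 2 * \<phi>\<^sup>2 / (1 + 1 / \<phi>) * \<delta> (Suc k) + 6 / (1 + 1 / \<phi>) * \<delta> k + 8 / (1 + 1 / \<phi>)
      * (4 * \<delta> (Suc k) + 2 * (R + norm zs) * sqrt (2 / (1 + 1 / \<phi>) * \<delta> (Suc k)))) \<longlonglongrightarrow> 0" by simp
  have "(\<lambda>k. (norm (z (Suc (Suc (Suc k))) - zb (Suc (Suc k))))\<^sup>2) \<longlonglongrightarrow> 0"
    by (rule tendsto_sandwich[OF always_eventually always_eventually tendsto_const lim])
      (simp, intro allI prox_displacement_bound[OF R \<delta>_def])
  from tendsto_real_sqrt[OF this] have "(\<lambda>k. norm (z (Suc (Suc (Suc k))) - zb (Suc (Suc k)))) \<longlonglongrightarrow> 0" by simp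
  then have "(\<lambda>k. norm (z (Suc k) - zb k)) \<longlonglongrightarrow> 0"
    using LIMSEQ_offset[of "\<lambda>k. norm (z (Suc k) - zb k)" 2] by (simp add: add_2_eq_Suc')
  then show ?thesis by (rule tendsto_norm_zero_cancel)
qed

lemma z_minus_zb_vanishes: "(\<lambda>k. z k - zb k) \<longlonglongrightarrow> 0"
proof (rule LIMSEQ_imp_Suc)
  show "(\<lambda>k. z (Suc k) - zb (Suc k)) \<longlonglongrightarrow> 0"
    unfolding z_minus_zb using tendsto_scaleR[OF tendsto_const[of "inverse \<phi>"] prox_displacement_vanishes] by simp
qed

lemma z_step_vanishes: "(\<lambda>k. z (Suc k) - z k) \<longlonglongrightarrow> 0"
  using tendsto_diff[OF prox_displacement_vanishes z_minus_zb_vanishes] by simp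

text \<open>This is the starting energy of an excursion whose reference point is the iterate at
  which it begins.\<close>

lemma energy_current_vanishes: "(\<lambda>k. energy (z (Suc k)) (Suc k)) \<longlonglongrightarrow> 0"
proof (rule tendsto_sandwich[OF always_eventually always_eventually tendsto_const])
  define c where "c = \<phi> / (\<phi> - 1)"
  have c: "c > 0" using phi_gt by (simp add: c_def)
  have w: "(\<lambda>k. zb (Suc (Suc k)) - z (Suc k)) \<longlonglongrightarrow> 0"
    using tendsto_diff[OF LIMSEQ_Suc[OF z_step_vanishes] LIMSEQ_Suc[OF LIMSEQ_Suc[OF z_minus_zb_vanishes]]] by simp
  have "(\<lambda>k. c * (norm (zb (Suc (Suc k)) - z (Suc k)))\<^sup>2 + (1 + 1 / \<phi>) / 2 * (norm (z (Suc (Suc k)) - z (Suc k)))\<^sup>2)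
     \<longlonglongrightarrow> c * (norm (0::'a))\<^sup>2 + (1 + 1 / \<phi>) / 2 * (norm (0::'a))\<^sup>2"
    by (intro tendsto_add tendsto_mult_left tendsto_power tendsto_norm w LIMSEQ_Suc[OF z_step_vanishes])
  then show "(\<lambda>k. c * (norm (zb (Suc (Suc k)) - z (Suc k)))\<^sup>2 + (1 + 1 / \<phi>) / 2 * (norm (z (Suc (Suc k)) - z (Suc k)))\<^sup>2)
     \<longlonglongrightarrow> 0" by simp
  show "\<forall>k. 0 \<le> energy (z (Suc k)) (Suc k)" using energy_nonneg by blast
  show "\<forall>k. energy (z (Suc k)) (Suc k) \<le> c * (norm (zb (Suc (Suc k)) - z (Suc k)))\<^sup>2 + (1 + 1 / \<phi>) / 2 * (norm (z (Suc (Suc k)) - z (Suc k)))\<^sup>2"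
    unfolding energy_def c_def using th_le by (auto intro!: mult_right_mono divide_right_mono)
qed


subsection \<open>Cluster points lie in the domain\<close>

lemma limit_in_domain:
  assumes zlim: "z \<longlonglongrightarrow> b" and zblim: "zb \<longlonglongrightarrow> b"
  shows "b \<in> D"
proof (rule ccontr)
  assume bD: "b \<notin> D"
  have blowup: "\<forall>\<^sub>F k in sequentially. c < G (z (Suc k))" for c
    by (rule tends_to_infinity_outside[OF z_in LIMSEQ_Suc[OF zlim] bD])
  have b_cl: "b \<in> closure D"
    using zblim zb_in closure_sequential by blast
  then have b_aff: "b \<in> affine hull D" using closure_affine_hull by blast
  \<comment> \<open>The polytope supplies a relative neighbourhood of \<open>p\<close> inside
    \<open>D\<close> on which \<open>G\<close> is bounded above, by its maximum over the vertices.
    The product will be nondecreasing for large \<open>k\<close> with limit 0, hence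
    nonpositive.\<close>
  have inward: "\<forall>\<^sub>F k in sequentially. inner (zb k - b) (p - b) \<le> 0"
    if B: "finite B" "B \<subseteq> D" "affine hull B = affine hull D" and p: "p \<in> rel_interior (convex hull B)" for B p
  proof -
    obtain e where e: "e > 0" "cball p e \<inter> affine hull D \<subseteq> convex hull B"
      using p B(3) unfolding mem_rel_interior_cball by auto
    have hullD: "convex hull B \<subseteq> D" using B(2) convex_D by (rule hull_minimal)
    have pB: "p \<in> convex hull B" using p rel_interior_subset by blast
    then have pD: "p \<in> D" using hullD by blast
    define M where "M = Max (G ` B)"
    have "B \<subseteq> {x \<in> D. G x \<le> M}" using B by (auto simp: M_def)
    then have "convex hull B \<subseteq> {x \<in> D. G x \<le> M}" by (rule hull_minimal[where S = convex]) (rule convex_sublevel)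
    then have M: "G x \<le> M" if "x \<in> convex hull B" for x using that by blast
    obtain \<delta> L where \<delta>: "\<delta> > 0" "L-lipschitz_on (cball p \<delta> \<inter> D) F" using F_lipschitz[OF pD] by blast
    have L: "L \<ge> 0" using \<delta>(2) by (rule lipschitz_on_nonneg)
    define K where "K = norm (F p) + L * \<delta>"
    have FK: "norm (F q) \<le> K" if "q \<in> D" "norm (q - p) \<le> \<delta>" for q
    proof -
      have "dist (F q) (F p) \<le> L * dist q p"
        using that pD \<delta> by (intro lipschitz_onD[OF \<delta>(2)]) (auto simp: dist_norm norm_minus_commute)
      also have "\<dots> \<le> L * \<delta>" using that L by (intro mult_left_mono) (auto simp: dist_norm)
      finally show ?thesis unfolding K_def using norm_triangle_sub[of "F q" "F p"] by (simp add: dist_norm)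
    qed
    have "\<forall>\<^sub>F k in sequentially. dist (z k) b < min e \<delta>"
      using zlim e(1) \<delta>(1) by (intro tendstoD) auto
    then obtain N1 where N1: "\<And>k. k \<ge> N1 \<Longrightarrow> dist (z k) b < min e \<delta>"
      unfolding eventually_sequentially by blast
    obtain N2 where N2: "\<And>k. k \<ge> N2 \<Longrightarrow> M + K * norm (p - b) < G (z (Suc k))"
      using blowup[of "M + K * norm (p - b)"] unfolding eventually_sequentially by blast
    define N where "N = max N1 N2"
    have N: "dist (z (Suc k)) b < min e \<delta> \<and> dist (z (Suc (Suc k))) b < min e \<delta>
        \<and> M + K * norm (p - b) < G (z (Suc (Suc k)))" if "k \<ge> N" for k
      using that N1[of "Suc k"] N1[of "Suc (Suc k)"] N2[of "Suc k"] by (simp add: N_def)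
    \<comment> \<open>Translating the barrier point \<open>p\<close> along with the iterates keeps it where \<open>g\<close> and \<open>F\<close> are bounded,
      whereas \<open>g\<close> explodes along the iterates.\<close>
    have step: "inner (zb (Suc k) - b) (p - b) \<le> inner (zb (Suc (Suc k)) - b) (p - b)" if "k \<ge> N" for k
    proof -
      let ?a = "z (Suc (Suc k))" and ?l = "lam (Suc k)"
      define p' where "p' = p + (?a - b)"
      define q where "q = p + (z (Suc k) - b)"
      have shift: "p + (x - b) \<in> convex hull B" if "x \<in> D" "dist x b < e" for x
      proof -
        have "p + 1 *\<^sub>R (x - b) \<in> affine hull D"
          using that pD b_aff by (intro mem_affine_3_minus) (auto intro: hull_inc)
        moreover have "p + (x - b) \<in> cball p e" using that by (simp add: dist_norm norm_minus_commute)
        ultimately show ?thesis using e(2) by auto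
      qed
      have p': "p' \<in> convex hull B" unfolding p'_def using N[OF that] z_in by (intro shift) auto
      have q: "q \<in> convex hull B" unfolding q_def using N[OF that] z_in by (intro shift) auto
      have p'D: "p' \<in> D" and qD: "q \<in> D" using p' q hullD by auto
      have qz: "q - z (Suc k) = p - b" "p' - ?a = p - b" by (simp_all add: q_def p'_def)
      have "norm (q - p) \<le> \<delta>" unfolding q_def using N[OF that] by (simp add: dist_norm)
      then have "norm (F q) * norm (p - b) \<le> K * norm (p - b)" using FK[OF qD] by (intro mult_right_mono) auto
      then have "inner (F q) (p - b) \<le> K * norm (p - b)"
        using norm_cauchy_schwarz[of "F q" "p - b"] by linarith
      \<comment> \<open>\<open>q\<close> differs from the iterate by \<open>p - b\<close>, so
        monotonicity bounds \<open>F\<close> at the iterate in just the direction needed, although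
        its norm may explode near \<open>b\<close>.\<close>
      moreover have "inner (F (z (Suc k))) (p - b) \<le> inner (F q) (p - b)"
        using F_mono[OF qD z_in[of k]] by (simp add: qz inner_diff_left)
      ultimately have "0 \<le> G ?a - G p' - inner (F (z (Suc k))) (p - b)"
        using N[OF that] M[OF p'] by linarith
      then have "0 \<le> ?l * (G ?a - G p' - inner (F (z (Suc k))) (p - b))"
        using lam_pos[of "Suc k"] by simp
      also have "\<dots> = ?l * (G ?a - G p') - ?l * inner (F (z (Suc k))) (p - b)" by (simp add: algebra_simps)
      also have "\<dots> \<le> inner (?a - zb (Suc k)) (p - b)"
        using z_prox[OF p'D, of k] by (simp add: qz inner_add_left)
      finally have "0 \<le> (\<phi> - 1) / \<phi> * inner (?a - zb (Suc k)) (p - b)" using phi_gt by simp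
      then have "0 \<le> inner (zb (Suc (Suc k)) - zb (Suc k)) (p - b)" unfolding zb_step by simp
      then show ?thesis by (simp add: inner_diff_left)
    qed
    have "incseq (\<lambda>k. inner (zb (Suc (k + N)) - b) (p - b))" using step by (intro incseq_SucI) simp
    moreover have "(\<lambda>k. inner (zb (Suc (k + N)) - b) (p - b)) \<longlonglongrightarrow> inner (b - b) (p - b)"
      by (intro tendsto_intros LIMSEQ_ignore_initial_segment[OF LIMSEQ_Suc[OF zblim]])
    ultimately have "inner (zb (Suc (k + N)) - b) (p - b) \<le> 0" for k using incseq_le by fastforce
    then have "inner (zb k - b) (p - b) \<le> 0" if "k \<ge> Suc N" for k
      using that by (metis add.commute add_Suc le_Suc_ex)
    then show ?thesis unfolding eventually_sequentially by blast
  qed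
  \<comment> \<open>The denominators are positive because \<open>zb k\<close> lies in
    \<open>D\<close> and \<open>b\<close> does not.\<close>
  define h where "h k = (zb k - b) /\<^sub>R norm (zb k - b)" for k
  have nz: "norm (zb k - b) > 0" for k using zb_in[of k] bD by auto
  then have h1: "norm (h k) = 1" for k by (simp add: h_def)
  then have "bounded (range h)" by (intro boundedI[of _ 1]) auto
  then obtain u r where r: "strict_mono (r :: nat \<Rightarrow> nat)" "(h \<circ> r) \<longlonglongrightarrow> u"
    using bounded_imp_convergent_subsequence by blast
  obtain B where B: "B \<subseteq> D" "\<not> affine_dependent B" "affine hull D = affine hull B"
    using affine_basis_exists[of D] by blast
  then have finB: "finite B" using aff_independent_finite by blast
  have u_le: "inner u (p - b) \<le> 0" if pD: "p \<in> D" for p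
  proof -
    \<comment> \<open>Adding \<open>p\<close> to an affine basis gives a polytope of full relative
      dimension that contains \<open>p\<close>. \<open>inward\<close> covers its relative interior,
      and \<open>p\<close> is reached by closure.\<close>
    define S where "S = convex hull (insert p B)"
    have affS: "affine hull (insert p B) = affine hull D"
    proof (rule antisym)
      show "affine hull (insert p B) \<subseteq> affine hull D" using pD B(1) by (intro hull_mono) auto
      show "affine hull D \<subseteq> affine hull (insert p B)" unfolding B(3) by (intro hull_mono) auto
    qed
    have "inner u (q - b) \<le> 0" if "q \<in> rel_interior S" for q
    proof -
      have "\<forall>\<^sub>F k in sequentially. inner (zb k - b) (q - b) \<le> 0"
        by (rule inward[of "insert p B"]) (use finB B pD affS that in \<open>auto simp: S_def\<close>)
      then have "\<forall>\<^sub>F k in sequentially. inner (h k) (q - b) \<le> 0"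
      proof eventually_elim
        case (elim k)
        have "inner (h k) (q - b) = inverse (norm (zb k - b)) * inner (zb k - b) (q - b)"
          by (simp add: h_def)
        also have "\<dots> \<le> 0" using nz[of k] elim by (intro mult_nonneg_nonpos) auto
        finally show ?case .
      qed
      then have "\<forall>\<^sub>F k in sequentially. inner ((h \<circ> r) k) (q - b) \<le> 0"
        unfolding o_def by (rule eventually_subseq[OF r(1)])
      moreover have "(\<lambda>k. inner ((h \<circ> r) k) (q - b)) \<longlonglongrightarrow> inner u (q - b)" by (intro tendsto_intros r(2))
      ultimately show ?thesis by (intro tendsto_upperbound[where F = sequentially]) auto
    qed
    then have "rel_interior S \<subseteq> {q. inner u (q - b) \<le> 0}" by auto
    moreover have "closed {q. inner u (q - b) \<le> 0}" by (intro closed_Collect_le continuous_intros)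
    ultimately have "closure (rel_interior S) \<subseteq> {q. inner u (q - b) \<le> 0}" by (rule closure_minimal)
    moreover have "p \<in> closure (rel_interior S)"
    proof -
      have "p \<in> S" unfolding S_def by (simp add: hull_inc)
      then show ?thesis using convex_closure_rel_interior[of S] closure_subset[of S] by (auto simp: S_def)
    qed
    ultimately show ?thesis by auto
  qed
  have "inner u (h k) \<le> 0" for k
    using mult_nonneg_nonpos[OF _ u_le[OF zb_in[of k]], of "inverse (norm (zb k - b))"] nz[of k]
    by (simp add: h_def)
  then have "inner u ((h \<circ> r) k) \<le> 0" for k by simp
  moreover have "(\<lambda>k. inner u ((h \<circ> r) k)) \<longlonglongrightarrow> inner u u" by (intro tendsto_intros r(2))
  ultimately have "inner u u \<le> 0" using LIMSEQ_le_const2 by blast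
  then have "u = 0" using inner_gt_zero_iff[of u] by (metis not_less)
  moreover have "(\<lambda>k. norm ((h \<circ> r) k)) \<longlonglongrightarrow> norm u" by (intro tendsto_intros r(2))
  then have "norm u = 1" using h1 by (simp add: LIMSEQ_const_iff)
  ultimately show False by simp
qed

section \<open>Bounds on sublevel sets and growth of the energy\<close>

lemma F_tendsto:
  assumes X: "\<And>n. X n \<in> D" "X \<longlonglongrightarrow> x" and x: "x \<in> D"
  shows "(\<lambda>n. F (X n)) \<longlonglongrightarrow> F x"
proof -
  obtain \<delta> L where \<delta>: "\<delta> > 0" "L-lipschitz_on (cball x \<delta> \<inter> D) F" using F_lipschitz[OF x] by blast
  have "\<forall>\<^sub>F n in sequentially. dist (X n) x < \<delta>" using X(2) \<delta>(1) by (rule tendstoD)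
  then have "\<forall>\<^sub>F n in sequentially. dist (F (X n)) (F x) \<le> L * dist (X n) x"
  proof eventually_elim
    case (elim n)
    then show ?case using X(1) x \<delta>(1) by (intro lipschitz_onD[OF \<delta>(2)]) (auto simp: dist_commute)
  qed
  moreover have "(\<lambda>n. L * dist (X n) x) \<longlonglongrightarrow> L * dist x x" by (intro tendsto_intros X(2))
  then have "(\<lambda>n. L * dist (X n) x) \<longlonglongrightarrow> 0" by simp
  ultimately have "(\<lambda>n. dist (F (X n)) (F x)) \<longlonglongrightarrow> 0"
    by (intro tendsto_sandwich[OF always_eventually[OF allI[OF zero_le_dist]] _ tendsto_const])
  then show ?thesis by (rule iffD2[OF tendsto_dist_iff])
qed

text \<open>\<open>D\<close> need not be closed, but its sublevel sets are; this is what gives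
  uniform bounds of \<open>F\<close> at reference points of low value.\<close>

lemma compact_bounded_sublevel: "compact {x \<in> D. G x \<le> c \<and> norm x \<le> R}"
proof -
  have "closed {x \<in> D. G x \<le> c \<and> norm x \<le> R}"
    unfolding closed_sequential_limits
  proof (intro allI impI)
    fix X l assume X: "(\<forall>n. X n \<in> {x \<in> D. G x \<le> c \<and> norm x \<le> R}) \<and> X \<longlonglongrightarrow> l"
    then have "l \<in> D \<and> G l \<le> c" by (intro closed_epigraph[of X l "\<lambda>_. c"]) auto
    moreover have "norm l \<le> R"
      using X by (intro LIMSEQ_le_const2[OF tendsto_norm]) auto
    ultimately show "l \<in> {x \<in> D. G x \<le> c \<and> norm x \<le> R}" by simp
  qed
  moreover have "bounded {x \<in> D. G x \<le> c \<and> norm x \<le> R}" by (rule boundedI[of _ R]) auto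
  ultimately show ?thesis by (simp add: compact_eq_bounded_closed)
qed

lemma F_bounded_on_sublevel: "\<exists>M\<ge>0. \<forall>x\<in>D. G x \<le> c \<longrightarrow> norm x \<le> R \<longrightarrow> norm (F x) \<le> M"
proof -
  let ?K = "{x \<in> D. G x \<le> c \<and> norm x \<le> R}"
  have "continuous_on ?K F" unfolding continuous_on_sequentially
    using F_tendsto by (auto simp: o_def)
  then have "bounded (F ` ?K)" using compact_bounded_sublevel compact_continuous_image compact_imp_bounded by blast
  then obtain M where "M > 0" "\<And>y. y \<in> F ` ?K \<Longrightarrow> norm y \<le> M" unfolding bounded_pos by blast
  then show ?thesis by (intro exI[of _ M]) auto
qed

text \<open>The energy at an arbitrary \<open>p\<close> grows only through negative gaps, hence at
  most proportionally to the elapsed time, measured by the sum of the steps.\<close>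

lemma energy_growth:
  assumes p: "p \<in> D" and mn: "m \<le> n"
    and C: "\<And>i. m \<le> i \<Longrightarrow> i < n \<Longrightarrow> - gap p (z (Suc (Suc i))) \<le> C"
  shows "energy p (Suc n) \<le> energy p (Suc m) + 2 * C * (\<Sum>i=m..<n. lam (Suc (Suc i)))"
  using mn C
proof (induction rule: dec_induct)
  case (step n)
  have "lam (Suc (Suc n)) * - gap p (z (Suc (Suc n))) \<le> lam (Suc (Suc n)) * C"
    using step.prems[of n] step.hyps lam_pos[of "Suc (Suc n)"] by (intro mult_left_mono) auto
  moreover have "energy p (Suc n) \<le> energy p (Suc m) + 2 * C * (\<Sum>i=m..<n. lam (Suc (Suc i)))"
    using step by auto
  ultimately show ?case using energy_gap_decrease[OF p, of n] step.hyps
    by (simp add: algebra_simps)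
qed simp


lemma gap_lower_bound:
  assumes "norm p \<le> R" "norm x \<le> R" "norm (F p) \<le> M" "G p \<le> G x"
  shows "- gap p x \<le> M * (2 * R)"
proof -
  have "- inner (F p) (x - p) \<le> norm (F p) * norm (p - x)"
    using norm_cauchy_schwarz[of "F p" "p - x"] by (simp add: inner_diff_right)
  also have "\<dots> \<le> M * (2 * R)"
    using assms norm_triangle_ineq4[of p x] norm_ge_zero[of "F p"] norm_ge_zero[of "p - x"]
    by (intro mult_mono) linarith+
  finally show ?thesis using assms(4) unfolding gap_def by linarith
qed

text \<open>The threshold compensates the linear term of the gap at \<open>zs\<close>, so that this
  gap is at least 1 above it; the time spent there is then dominated by a gap sum that the initial
  energy bounds.\<close>

lemma time_above_threshold_summable:
  "\<exists>c. summable (\<lambda>i. if c < G (z (Suc (Suc i))) then lam (Suc (Suc i)) else 0)"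
proof -
  obtain R where R: "\<And>k. norm (z k) \<le> R" using bounded_iterates by blast
  define c where "c = 1 + G zs + norm (F zs) * (R + norm zs)"
  have gap1: "1 \<le> gap zs (z k)" if "c < G (z k)" for k
  proof -
    have "norm (zs - z k) \<le> R + norm zs" using norm_triangle_ineq4[of zs "z k"] R[of k] by simp
    then have "norm (F zs) * norm (zs - z k) \<le> norm (F zs) * (R + norm zs)" by (intro mult_left_mono) auto
    then have "- inner (F zs) (z k - zs) \<le> norm (F zs) * (R + norm zs)"
      using norm_cauchy_schwarz[of "F zs" "zs - z k"] by (simp add: inner_diff_right)
    then show ?thesis using that unfolding gap_def c_def by linarith
  qed
  let ?\<mu> = "\<lambda>i. if c < G (z (Suc (Suc i))) then lam (Suc (Suc i)) else 0"
  have "summable ?\<mu>"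
  proof (rule summableI_nonneg_bounded)
    fix n
    show "0 \<le> ?\<mu> n" using lam_pos[of "Suc (Suc n)"] by simp
    have "?\<mu> i \<le> 2 * lam (Suc (Suc i)) * gap zs (z (Suc (Suc i)))" for i
    proof (cases "c < G (z (Suc (Suc i)))")
      case True
      then have "lam (Suc (Suc i)) * 1 \<le> 2 * lam (Suc (Suc i)) * gap zs (z (Suc (Suc i)))"
        using gap1 lam_pos[of "Suc (Suc i)"] by (intro mult_mono) auto
      then show ?thesis using True by simp
    next
      case False
      then show ?thesis using gap_zs_nonneg[OF z_in] lam_pos[of "Suc (Suc i)"] by simp
    qed
    then have "sum ?\<mu> {..<n} \<le> (\<Sum>i<n. 2 * lam (Suc (Suc i)) * gap zs (z (Suc (Suc i))))"
      by (intro sum_mono)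
    also have "\<dots> \<le> energy zs (Suc 0)" using sum_gap_le[OF zs_in, of n] energy_nonneg[of zs n] by linarith
    finally show "sum ?\<mu> {..<n} \<le> energy zs (Suc 0)" .
  qed
  then show ?thesis by blast
qed

lemma zb_Suc_minus_z_vanishes: "(\<lambda>k. zb (Suc k) - z k) \<longlonglongrightarrow> 0"
  using tendsto_diff[OF z_step_vanishes LIMSEQ_Suc[OF z_minus_zb_vanishes]] by simp

text \<open>An excursion from the last iterate \<open>p\<close> below the threshold to \<open>z (s j)\<close> stays above the
  threshold, where \<open>energy p\<close> can only grow by a multiple of the (summable) time spent there.\<close>
lemma cluster_point_in_domain_frequently_low:
  assumes s: "strict_mono s" and lim: "(\<lambda>j. z (s j)) \<longlonglongrightarrow> b"
    and summ: "summable (\<lambda>i. if c < G (z (Suc (Suc i))) then lam (Suc (Suc i)) else 0)"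
    and low: "\<And>N. \<exists>k\<ge>N. G (z (Suc k)) \<le> c"
  shows "b \<in> D"
proof (rule ccontr)
  assume bD: "b \<notin> D"
  obtain R where R: "\<And>k. norm (z k) \<le> R" using bounded_iterates by blast
  have R0: "R \<ge> 0" using R[of 0] norm_ge_zero order_trans by blast
  define \<mu> where "\<mu> i = (if c < G (z (Suc (Suc i))) then lam (Suc (Suc i)) else 0)" for i
  define T where "T n = (\<Sum>i<n. \<mu> i)" for n
  have T: "T \<longlonglongrightarrow> suminf \<mu>" unfolding T_def using summ summable_LIMSEQ unfolding \<mu>_def by blast
  obtain M where M: "M \<ge> 0" "\<And>x. x \<in> D \<Longrightarrow> G x \<le> c \<Longrightarrow> norm x \<le> R \<Longrightarrow> norm (F x) \<le> M"
    using F_bounded_on_sublevel[of c R] by blast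
  define C where "C = M * (2 * R)"
  have C: "C \<ge> 0" using M R0 by (simp add: C_def)
  define P where "P j k \<longleftrightarrow> Suc k \<le> s j \<and> G (z (Suc k)) \<le> c" for j k
  \<comment> \<open>\<open>z (Suc (m j))\<close> is the last iterate of value at most
    \<open>c\<close> with index between 1 and \<open>s j\<close>; the shift by one keeps it within
    the range of \<open>z_in\<close>.\<close>
  define m where "m j = (GREATEST k. P j k)" for j
  obtain k1 where k1: "G (z (Suc k1)) \<le> c" using low by blast
  have Pm: "P j (m j)" if "P j k" for j k
    unfolding m_def by (rule GreatestI_nat[where P = "P j" and k = k and b = "s j"]) (use that in \<open>auto simp: P_def\<close>)
  have mge: "k \<le> m j" if "P j k" for j k
    unfolding m_def by (rule Greatest_le_nat[where P = "P j" and b = "s j"]) (use that in \<open>auto simp: P_def\<close>)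
  have s_ge: "j \<le> s j" for j using seq_suble[OF s] .
  have m_inf: "filterlim m at_top sequentially"
    unfolding filterlim_at_top eventually_sequentially
  proof
    fix N
    obtain k where k: "k \<ge> N" "G (z (Suc k)) \<le> c" using low by blast
    have "N \<le> m j" if "j \<ge> Suc k" for j
      using mge[of j k] k that s_ge[of j] by (simp add: P_def)
    then show "\<exists>n. \<forall>j\<ge>n. N \<le> m j" by blast
  qed
  have s_inf: "filterlim s at_top sequentially" using s by (rule filterlim_subseq)
  have sj: "\<forall>\<^sub>F j in sequentially. c < G (z (s j))"
  proof -
    have "\<forall>\<^sub>F j in sequentially. c < G (z (s (Suc j)))"
    proof (rule tends_to_infinity_outside[OF _ LIMSEQ_Suc[OF lim] bD])
      fix j
      have "s (Suc j) \<noteq> 0" using s_ge[of "Suc j"] by simp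
      then show "z (s (Suc j)) \<in> D" using z_in by (metis not0_implies_Suc)
    qed
    then show ?thesis by (simp add: eventually_sequentially_Suc[of "\<lambda>j. c < G (z (s j))"])
  qed
  define p where "p j = z (Suc (m j))" for j
  have bound: "\<forall>\<^sub>F j in sequentially. (norm (zb (Suc (s j)) - p j))\<^sup>2
      \<le> energy (p j) (Suc (m j)) + 2 * C * (T (s j - 1) - T (m j))"
    using sj eventually_ge_at_top[of "Suc k1"]
  proof eventually_elim
    case (elim j)
    have "P j k1" using elim k1 s_ge[of j] by (simp add: P_def)
    note Pj = Pm[OF this]
    define n where "n = s j - 1"
    have "s j \<noteq> Suc (m j)" using Pj elim unfolding P_def by auto
    then have n: "s j = Suc n" "m j < n" using Pj unfolding P_def n_def by auto
    have high: "c < G (z (Suc (Suc i)))" if "m j \<le> i" "i < n" for i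
      using mge[of j "Suc i"] that n by (force simp: P_def)
    have pj: "p j \<in> D" "G (p j) \<le> c" "norm (p j) \<le> R" using Pj z_in R by (auto simp: p_def P_def)
    have "energy (p j) (Suc n) \<le> energy (p j) (Suc (m j)) + 2 * C * (\<Sum>i=m j..<n. lam (Suc (Suc i)))"
    proof (rule energy_growth[OF pj(1)])
      show "m j \<le> n" using n by simp
      show "- gap (p j) (z (Suc (Suc i))) \<le> C" if "m j \<le> i" "i < n" for i
        unfolding C_def using pj R high[OF that] by (intro gap_lower_bound M(2)) auto
    qed
    also have "(\<Sum>i=m j..<n. lam (Suc (Suc i))) = (\<Sum>i=m j..<n. \<mu> i)"
      using high by (intro sum.cong) (auto simp: \<mu>_def)
    also have "\<dots> = T n - T (m j)"
      using n sum_diff_nat_ivl[of 0 "m j" n \<mu>] by (simp add: T_def atLeast0LessThan)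
    finally show ?case using energy_ge[of n "p j"] n by simp
  qed
  \<comment> \<open>The excursion times are differences of partial sums of a convergent series whose
    two indices both tend to infinity.\<close>
  have "(\<lambda>j. energy (p j) (Suc (m j)) + 2 * C * (T (s j - 1) - T (m j))) \<longlonglongrightarrow>
      0 + 2 * C * (suminf \<mu> - suminf \<mu>)"
  proof (intro tendsto_add tendsto_mult_left tendsto_diff)
    show "(\<lambda>j. energy (p j) (Suc (m j))) \<longlonglongrightarrow> 0"
      unfolding p_def by (rule filterlim_compose[OF energy_current_vanishes m_inf])
    show "(\<lambda>j. T (m j)) \<longlonglongrightarrow> suminf \<mu>" by (rule filterlim_compose[OF T m_inf])
    have "filterlim (\<lambda>j. s j - 1) at_top sequentially"
      by (rule filterlim_compose[OF filterlim_minus_const_nat_at_top s_inf])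
    then show "(\<lambda>j. T (s j - 1)) \<longlonglongrightarrow> suminf \<mu>" by (rule filterlim_compose[OF T])
  qed
  then have lim0: "(\<lambda>j. energy (p j) (Suc (m j)) + 2 * C * (T (s j - 1) - T (m j))) \<longlonglongrightarrow> 0" by simp
  have "(\<lambda>j. (norm (zb (Suc (s j)) - p j))\<^sup>2) \<longlonglongrightarrow> 0"
    by (rule tendsto_sandwich[OF _ bound tendsto_const lim0]) simp
  from tendsto_real_sqrt[OF this] have "(\<lambda>j. norm (zb (Suc (s j)) - p j)) \<longlonglongrightarrow> 0" by simp
  then have A: "(\<lambda>j. zb (Suc (s j)) - p j) \<longlonglongrightarrow> 0" by (rule tendsto_norm_zero_cancel)
  have B: "(\<lambda>j. zb (Suc (s j)) - z (s j)) \<longlonglongrightarrow> 0"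
    by (rule filterlim_compose[OF zb_Suc_minus_z_vanishes s_inf])
  have "(\<lambda>j. (zb (Suc (s j)) - z (s j)) + z (s j) - (zb (Suc (s j)) - p j)) \<longlonglongrightarrow> 0 + b - 0"
    by (intro tendsto_add tendsto_diff A B lim)
  then have "p \<longlonglongrightarrow> b" by simp
  then have "(\<lambda>j. p (j + Suc k1)) \<longlonglongrightarrow> b" by (rule LIMSEQ_ignore_initial_segment)
  moreover have "G (p (j + Suc k1)) \<le> c" for j
  proof -
    have "P (j + Suc k1) k1" using k1 s_ge[of "j + Suc k1"] by (simp add: P_def)
    from Pm[OF this] show ?thesis by (simp add: P_def p_def)
  qed
  ultimately have "b \<in> D \<and> G b \<le> c"
    by (intro closed_epigraph[of "\<lambda>j. p (j + Suc k1)" b "\<lambda>_. c"]) (auto simp: p_def z_in)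
  then show False using bD by simp
qed

text \<open>As the total time is finite, \<open>energy p\<close> minus a multiple of the elapsed
  time decreases for large indices and stays bounded below, so the distance of \<open>zb\<close>
  from every \<open>p\<close> in \<open>D\<close> converges. A single cluster point then attracts
  the whole sequence, the situation of \<open>limit_in_domain\<close>.\<close>

lemma cluster_point_in_domain_summable:
  assumes s: "strict_mono s" and lim: "(\<lambda>j. z (s j)) \<longlonglongrightarrow> b"
    and summ: "summable (\<lambda>i. lam (Suc (Suc i)))"
    and high: "\<And>k. N \<le> k \<Longrightarrow> c < G (z (Suc k))"
  shows "b \<in> D"
proof -
  obtain R where R: "\<And>k. norm (z k) \<le> R" using bounded_iterates by blast
  define \<mu> where "\<mu> i = lam (Suc (Suc i))" for i
  define T where "T n = (\<Sum>i<n. \<mu> i)" for n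
  have T: "T \<longlonglongrightarrow> suminf \<mu>" unfolding T_def using summ summable_LIMSEQ unfolding \<mu>_def by blast
  have s_inf: "filterlim s at_top sequentially" using s by (rule filterlim_subseq)
  define a where "a = \<phi> / (\<phi> - 1)"
  have a: "a > 0" using phi_gt by (simp add: a_def)
  have step0: "(\<lambda>k. th (Suc k) / 2 * (norm (z (Suc (Suc k)) - z (Suc k)))\<^sup>2) \<longlonglongrightarrow> 0"
  proof (rule tendsto_sandwich[OF always_eventually always_eventually tendsto_const])
    have "(\<lambda>k. (1 + 1 / \<phi>) / 2 * (norm (z (Suc (Suc k)) - z (Suc k)))\<^sup>2) \<longlonglongrightarrow> (1 + 1 / \<phi>) / 2 * (norm (0::'a))\<^sup>2"
      by (intro tendsto_mult_left tendsto_power tendsto_norm LIMSEQ_Suc[OF z_step_vanishes])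
    then show "(\<lambda>k. (1 + 1 / \<phi>) / 2 * (norm (z (Suc (Suc k)) - z (Suc k)))\<^sup>2) \<longlonglongrightarrow> 0" by simp
    show "\<forall>k. 0 \<le> th (Suc k) / 2 * (norm (z (Suc (Suc k)) - z (Suc k)))\<^sup>2"
      using th_pos by (simp add: less_imp_le)
    show "\<forall>k. th (Suc k) / 2 * (norm (z (Suc (Suc k)) - z (Suc k)))\<^sup>2
        \<le> (1 + 1 / \<phi>) / 2 * (norm (z (Suc (Suc k)) - z (Suc k)))\<^sup>2"
      using th_le by (auto intro!: mult_right_mono divide_right_mono)
  qed
  have zbs: "(\<lambda>j. zb (Suc (Suc (s j)))) \<longlonglongrightarrow> b"
  proof -
    have "(\<lambda>j. (zb (Suc (Suc (s j))) - z (Suc (s j))) + (z (Suc (s j)) - z (s j)) + z (s j)) \<longlonglongrightarrow> 0 + 0 + b"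
      by (intro tendsto_add lim filterlim_compose[OF LIMSEQ_Suc[OF zb_Suc_minus_z_vanishes] s_inf]
          filterlim_compose[OF z_step_vanishes s_inf])
    then show ?thesis by simp
  qed
  have dist_lim: "(\<lambda>k. norm (zb (Suc (Suc k)) - p)) \<longlonglongrightarrow> norm (b - p)" if p: "p \<in> D" for p
  proof -
    define C where "C = norm (F p) * (norm p + R) + \<bar>G p - c\<bar>"
    have C: "- gap p (z (Suc k)) \<le> C" if "N \<le> k" for k
    proof -
      have "norm (p - z (Suc k)) \<le> norm p + R" using norm_triangle_ineq4[of p "z (Suc k)"] R[of "Suc k"] by simp
      then have "norm (F p) * norm (p - z (Suc k)) \<le> norm (F p) * (norm p + R)" by (intro mult_left_mono) auto
      then have "- inner (F p) (z (Suc k) - p) \<le> norm (F p) * (norm p + R)"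
        using norm_cauchy_schwarz[of "F p" "p - z (Suc k)"] by (simp add: inner_diff_right)
      then show ?thesis using high[OF that] unfolding gap_def C_def by linarith
    qed
    have "R \<ge> 0" using R[of 0] norm_ge_zero order_trans by blast
    then have C0: "C \<ge> 0" unfolding C_def by simp
    define W where "W k = energy p (Suc (k + N)) - 2 * C * T (k + N)" for k
    have T_le: "T k \<le> suminf \<mu>" for k
    proof -
      have "summable \<mu>" unfolding \<mu>_def by (rule summ)
      then show ?thesis unfolding T_def by (rule sum_le_suminf) (auto simp: \<mu>_def lam_pos less_imp_le)
    qed
    have "W (Suc k) \<le> W k" for k
    proof -
      have "energy p (Suc (Suc (k + N))) \<le> energy p (Suc (k + N)) + 2 * C * (\<Sum>i=k + N..<Suc (k + N). lam (Suc (Suc i)))"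
        using C by (intro energy_growth[OF p]) auto
      then show ?thesis unfolding W_def T_def \<mu>_def by (simp add: algebra_simps)
    qed
    then have dec: "decseq W" by (rule decseq_SucI)
    have "- (2 * C * suminf \<mu>) \<le> W k" for k
    proof -
      have "2 * C * T (k + N) \<le> 2 * C * suminf \<mu>" using C0 T_le by (intro mult_left_mono) auto
      then show ?thesis using energy_nonneg[of p "k + N"] unfolding W_def by linarith
    qed
    then obtain L where "W \<longlonglongrightarrow> L" using decseq_convergent[OF dec, of "- (2 * C * suminf \<mu>)"] by metis
    then have "(\<lambda>k. W k + 2 * C * T (k + N)) \<longlonglongrightarrow> L + 2 * C * suminf \<mu>"
      by (intro tendsto_add tendsto_mult_left LIMSEQ_ignore_initial_segment[OF T])
    then have "(\<lambda>k. energy p (Suc (k + N))) \<longlonglongrightarrow> L + 2 * C * suminf \<mu>" unfolding W_def by simp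
    then have "(\<lambda>k. energy p (Suc k)) \<longlonglongrightarrow> L + 2 * C * suminf \<mu>" by (rule LIMSEQ_offset[of "\<lambda>k. energy p (Suc k)"])
    from tendsto_diff[OF this step0]
    have E: "(\<lambda>k. a * (norm (zb (Suc (Suc k)) - p))\<^sup>2) \<longlonglongrightarrow> L + 2 * C * suminf \<mu>"
      unfolding energy_def a_def by simp
    have "(\<lambda>j. a * (norm (zb (Suc (Suc (s j))) - p))\<^sup>2) \<longlonglongrightarrow> a * (norm (b - p))\<^sup>2"
      by (intro tendsto_intros zbs)
    moreover have "(\<lambda>j. a * (norm (zb (Suc (Suc (s j))) - p))\<^sup>2) \<longlonglongrightarrow> L + 2 * C * suminf \<mu>"
      by (rule filterlim_compose[OF E s_inf])
    ultimately have "L + 2 * C * suminf \<mu> = a * (norm (b - p))\<^sup>2" using LIMSEQ_unique by blast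
    with tendsto_mult_left[OF E, of "inverse a"]
    have "(\<lambda>k. (norm (zb (Suc (Suc k)) - p))\<^sup>2) \<longlonglongrightarrow> (norm (b - p))\<^sup>2" using a by simp
    from tendsto_real_sqrt[OF this] show ?thesis by simp
  qed
  have "(\<lambda>k. zb (Suc (Suc k))) \<longlonglongrightarrow> b"
  proof (rule LIMSEQ_I)
    fix \<epsilon> :: real assume \<epsilon>: "\<epsilon> > 0"
    have "\<forall>\<^sub>F j in sequentially. dist (zb (Suc (Suc (s j)))) b < \<epsilon> / 3" using zbs \<epsilon> by (intro tendstoD) auto
    then obtain j where j: "dist (zb (Suc (Suc (s j)))) b < \<epsilon> / 3" unfolding eventually_sequentially by blast
    \<comment> \<open>\<open>b\<close> is not yet known to lie in \<open>D\<close>; an average close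
      to it serves as reference point.\<close>
    define p where "p = zb (Suc (Suc (s j)))"
    have p: "norm (b - p) < \<epsilon> / 3" using j by (simp add: p_def dist_norm norm_minus_commute)
    have "\<forall>\<^sub>F k in sequentially. norm (zb (Suc (Suc k)) - p) < norm (b - p) + \<epsilon> / 3"
      using \<epsilon> dist_lim[of p] zb_in by (intro order_tendstoD(2)) (auto simp: p_def)
    then obtain n where n: "\<And>k. k \<ge> n \<Longrightarrow> norm (zb (Suc (Suc k)) - p) < norm (b - p) + \<epsilon> / 3"
      unfolding eventually_sequentially by blast
    have "norm (zb (Suc (Suc k)) - b) < \<epsilon>" if "k \<ge> n" for k
      using n[OF that] p norm_triangle_ineq4[of "zb (Suc (Suc k)) - p" "b - p"] by simp
    then show "\<exists>n. \<forall>k\<ge>n. norm (zb (Suc (Suc k)) - b) < \<epsilon>" by blast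
  qed
  then have zblim: "zb \<longlonglongrightarrow> b"
    using LIMSEQ_offset[of zb 2] by (simp add: add_2_eq_Suc')
  have "(\<lambda>k. (z k - zb k) + zb k) \<longlonglongrightarrow> 0 + b" by (intro tendsto_add z_minus_zb_vanishes zblim)
  then have "z \<longlonglongrightarrow> b" by simp
  then show ?thesis using zblim by (rule limit_in_domain)
qed

lemma cluster_point_in_domain:
  assumes s: "strict_mono s" and lim: "(\<lambda>j. z (s j)) \<longlonglongrightarrow> b"
  shows "b \<in> D"
proof -
  obtain c where c: "summable (\<lambda>i. if c < G (z (Suc (Suc i))) then lam (Suc (Suc i)) else 0)"
    using time_above_threshold_summable by blast
  show ?thesis
  proof (cases "\<forall>N. \<exists>k\<ge>N. G (z (Suc k)) \<le> c")
    case True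
    then show ?thesis using cluster_point_in_domain_frequently_low[OF s lim c] by blast
  next
    case False
    then obtain N where N: "\<And>k. N \<le> k \<Longrightarrow> c < G (z (Suc k))" by (meson not_le)
    \<comment> \<open>From \<open>N\<close> on the condition always holds, so finite time above the
      threshold means finite total time.\<close>
    have "summable (\<lambda>i. lam (Suc (Suc i)))"
      using c by (rule summable_cong[THEN iffD1, rotated])
        (use N in \<open>auto simp: eventually_sequentially intro!: exI[of _ N]\<close>)
    then show ?thesis by (rule cluster_point_in_domain_summable[OF s lim _ N])
  qed
qed


subsection \<open>Step sizes and the ergodic rate\<close>

text \<open>Difference quotients growing without bound would accumulate at a point of
  \<open>D\<close>, where one Lipschitz constant serves both \<open>z (s j)\<close> and its
  successor, since consecutive iterates approach each other.\<close>

lemma lipschitz_along_iterates: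
  "\<exists>L>0. \<exists>N. \<forall>k\<ge>N. norm (F (z (Suc k)) - F (z k)) \<le> L * norm (z (Suc k) - z k)"
proof (rule ccontr)
  assume neg: "\<not> ?thesis"
  define bad where "bad n k \<longleftrightarrow> real (Suc n) * norm (z (Suc k) - z k) < norm (F (z (Suc k)) - F (z k))" for n k
  have ex: "\<exists>k\<ge>N. bad n k" for n N
    using neg unfolding bad_def by (metis not_le of_nat_0_less_iff zero_less_Suc)
  have "\<exists>f. \<forall>n. (f n \<ge> Suc 0 \<and> bad n (f n)) \<and> f n < f (Suc n)"
  proof (rule dependent_nat_choice)
    show "\<exists>k. k \<ge> Suc 0 \<and> bad 0 k" using ex by blast
    show "\<exists>y. (y \<ge> Suc 0 \<and> bad (Suc n) y) \<and> k < y" for k n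
      using ex[of "Suc k" "Suc n"] by (metis Suc_le_eq Suc_le_mono le_zero_eq less_eq_nat.simps(1) order_trans)
  qed
  then obtain f where f: "\<And>n. f n \<ge> Suc 0" "\<And>n. bad n (f n)" "\<And>n. f n < f (Suc n)" by blast
  have f_mono: "strict_mono f" using f(3) by (simp add: strict_mono_Suc_iff)
  obtain R where R: "\<And>k. norm (z k) \<le> R" using bounded_iterates by blast
  have "bounded (range (\<lambda>n. z (f n)))" using R by (intro boundedI[of _ R]) auto
  then obtain b r where r: "strict_mono (r :: nat \<Rightarrow> nat)" "((\<lambda>n. z (f n)) \<circ> r) \<longlonglongrightarrow> b"
    using bounded_imp_convergent_subsequence by blast
  define s where "s = f \<circ> r"
  have s: "strict_mono s" unfolding s_def using f_mono r(1) by (rule strict_mono_o)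
  have lim: "(\<lambda>j. z (s j)) \<longlonglongrightarrow> b" using r(2) by (simp add: s_def o_def)
  have bD: "b \<in> D" using s lim by (rule cluster_point_in_domain)
  have "(\<lambda>j. (z (Suc (s j)) - z (s j)) + z (s j)) \<longlonglongrightarrow> 0 + b"
    by (intro tendsto_add lim filterlim_compose[OF z_step_vanishes filterlim_subseq[OF s]])
  then have lim': "(\<lambda>j. z (Suc (s j))) \<longlonglongrightarrow> b" by simp
  obtain \<delta> L where \<delta>: "\<delta> > 0" "L-lipschitz_on (cball b \<delta> \<inter> D) F" using F_lipschitz[OF bD] by blast
  obtain n0 :: nat where n0: "L < real n0" using reals_Archimedean2 by blast
  have "\<forall>\<^sub>F j in sequentially. dist (z (s j)) b < \<delta> \<and> dist (z (Suc (s j))) b < \<delta> \<and> n0 \<le> j"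
    by (intro eventually_conj tendstoD[OF lim \<delta>(1)] tendstoD[OF lim' \<delta>(1)] eventually_ge_at_top)
  then obtain j where j: "dist (z (s j)) b < \<delta>" "dist (z (Suc (s j))) b < \<delta>" "n0 \<le> j"
    unfolding eventually_sequentially by blast
  have "z (s j) \<in> D" using z_in f(1)[of "r j"] unfolding s_def by (metis Suc_le_D comp_apply)
  then have "dist (F (z (Suc (s j)))) (F (z (s j))) \<le> L * dist (z (Suc (s j))) (z (s j))"
    using j z_in by (intro lipschitz_onD[OF \<delta>(2)]) (auto simp: dist_commute)
  also have "\<dots> \<le> real (Suc (r j)) * dist (z (Suc (s j))) (z (s j))"
    using n0 j(3) seq_suble[OF r(1), of j] by (intro mult_right_mono) auto
  finally show False using f(2)[of "r j"] unfolding bad_def s_def dist_norm by simp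
qed

lemma lam_bounded_below: "\<exists>c>0. \<forall>k. c \<le> lam k"
proof -
  obtain L N where L: "L > 0"
    and N: "\<And>k. k \<ge> N \<Longrightarrow> norm (F (z (Suc k)) - F (z k)) \<le> L * norm (z (Suc k) - z k)"
    using lipschitz_along_iterates by blast
  define \<Lambda> where "\<Lambda> = max lbar (lam 0)"
  have lam_le: "lam k \<le> \<Lambda>" for k using lam_le_lbar by (cases k) (auto simp: \<Lambda>_def le_max_iff_disj)
  have \<Lambda>: "\<Lambda> > 0" using lbar_pos by (simp add: \<Lambda>_def)
  \<comment> \<open>If the local entry is attained, inserting the definition of \<open>th\<close>
    gives a step of \<phi> squared times the squared step length, divided by 4 times
    \<open>lam k\<close> times the squared change of \<open>F\<close>. With
    \<open>lam k \<le> \<Lambda>\<close> and the constant \<open>L\<close> this is at least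
    \<open>c1\<close>.\<close>
  define c1 where "c1 = \<phi>\<^sup>2 / (4 * \<Lambda> * L\<^sup>2)"
  have c1: "c1 > 0" using phi_gt \<Lambda> L by (simp add: c1_def)
  define c where "c = min (lam (Suc N)) (min lbar c1)"
  have step: "min (lam (Suc k)) (min lbar c1) \<le> lam (Suc (Suc k))" if "k \<ge> N" for k
    using lam_cases[of "Suc k"]
  proof (elim disjE)
    assume "lam (Suc (Suc k)) = (1 / \<phi> + 1 / \<phi>\<^sup>2) * lam (Suc k)"
    moreover have "1 * lam (Suc k) \<le> (1 / \<phi> + 1 / \<phi>\<^sup>2) * lam (Suc k)"
      using rho_ge_1 lam_pos[of "Suc k"] by (intro mult_right_mono) auto
    ultimately show ?thesis by simp
  next
    assume "lam (Suc (Suc k)) = lbar"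
    then show ?thesis by simp
  next
    let ?f = "(norm (F (z (Suc (Suc k))) - F (z (Suc k))))\<^sup>2" and ?d = "(norm (z (Suc (Suc k)) - z (Suc k)))\<^sup>2"
    assume *: "F (z (Suc (Suc k))) \<noteq> F (z (Suc k)) \<and>
      4 * lam (Suc (Suc k)) * lam (Suc k) * ?f = \<phi> * th (Suc k) * ?d"
    have f: "?f > 0" using * by simp
    have pos: "lam (Suc k) > 0" "lam k > 0" using lam_pos by auto
    have fd: "?f \<le> L\<^sup>2 * ?d"
      using power_mono[OF N[of "Suc k"], of 2] that by (simp add: power_mult_distrib)
    have "4 * lam (Suc (Suc k)) * lam (Suc k) * ?f * lam k = \<phi> * th (Suc k) * ?d * lam k" using * by simp
    also have "\<dots> = lam (Suc k) * (\<phi>\<^sup>2 * ?d)" using pos by (simp add: th_Suc power2_eq_square)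
    finally have "lam (Suc k) * (4 * lam (Suc (Suc k)) * lam k * ?f) = lam (Suc k) * (\<phi>\<^sup>2 * ?d)"
      by (simp add: algebra_simps)
    then have eq: "4 * lam (Suc (Suc k)) * lam k * ?f = \<phi>\<^sup>2 * ?d" using pos by simp
    have "\<phi>\<^sup>2 * ?f \<le> \<phi>\<^sup>2 * (L\<^sup>2 * ?d)" using fd by (intro mult_left_mono) auto
    also have "\<dots> = L\<^sup>2 * (4 * lam (Suc (Suc k)) * lam k * ?f)" using eq by simp
    also have "\<dots> = lam k * (4 * L\<^sup>2 * lam (Suc (Suc k)) * ?f)" by (simp add: algebra_simps)
    also have "\<dots> \<le> \<Lambda> * (4 * L\<^sup>2 * lam (Suc (Suc k)) * ?f)"
      using lam_le lam_pos[of "Suc (Suc k)"] by (intro mult_right_mono) auto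
    also have "\<dots> = (lam (Suc (Suc k)) * (4 * \<Lambda> * L\<^sup>2)) * ?f" by (simp add: algebra_simps)
    finally have "\<phi>\<^sup>2 \<le> lam (Suc (Suc k)) * (4 * \<Lambda> * L\<^sup>2)" using f by (simp only: mult_le_cancel_right_pos)
    then have "c1 \<le> lam (Suc (Suc k))" unfolding c1_def using \<Lambda> L by (simp add: pos_divide_le_eq)
    then show ?thesis by simp
  qed
  have c_le: "c \<le> min lbar c1" unfolding c_def by (rule min.cobounded2)
  have late: "c \<le> lam (Suc k)" if "k \<ge> N" for k
    using that
  proof (induction rule: dec_induct)
    case base then show ?case by (simp add: c_def)
  next
    case (step n)
    have "c \<le> min (lam (Suc n)) (min lbar c1)" using step.IH c_le by simp
    then show ?case using \<open>\<And>k. k \<ge> N \<Longrightarrow> min (lam (Suc k)) (min lbar c1) \<le> lam (Suc (Suc k))\<close>[OF step.hyps(1)]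
      by (rule order_trans)
  qed
  define c' where "c' = min c (Min (lam ` {..N}))"
  have "c' > 0" unfolding c'_def c_def using lam_pos lbar_pos c1 by simp
  moreover have "c' \<le> lam k" for k
  proof (cases "k \<le> N")
    case True
    then have "Min (lam ` {..N}) \<le> lam k" by (intro Min_le) auto
    then show ?thesis unfolding c'_def by simp
  next
    case False
    then have "c \<le> lam k" using late[of "k - 1"] by (cases k) auto
    then show ?thesis unfolding c'_def by simp
  qed
  ultimately show ?thesis by blast
qed

section \<open>Ergodic averages\<close>

lemma sum_lam_ge_linear: "\<exists>c>0. \<forall>k. c * real k \<le> (\<Sum>i=1..k. lam i)"
proof -
  obtain c where c: "c > 0" "\<And>k. c \<le> lam k" using lam_bounded_below by blast
  have "c * real k \<le> (\<Sum>i=1..k. lam i)" for k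
    using sum_mono[of "{1..k}" "\<lambda>_. c" lam] c(2) by (simp add: mult.commute)
  then show ?thesis using c by blast
qed

lemma ergodic_gap_le:
  assumes "k \<ge> 1" "u \<in> D"
  shows "ergodic lam z k \<in> D"
    and "(\<Sum>i=1..k. lam i) * gap u (ergodic lam z k) \<le> (\<Sum>i=1..k. lam i * gap u (z i))"
proof -
  define S where "S = (\<Sum>i=1..k. lam i)"
  have S: "S > 0" unfolding S_def using assms lam_pos by (intro sum_pos) auto
  define a where "a i = lam i / S" for i
  have a: "(\<Sum>i=1..k. a i) = 1" "\<And>i. a i \<ge> 0"
    using S lam_pos by (simp_all add: a_def sum_divide_distrib[symmetric] S_def[symmetric] less_imp_le del: One_nat_def)
  have Z: "ergodic lam z k = (\<Sum>i=1..k. a i *\<^sub>R z i)"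
    unfolding ergodic_def S_def[symmetric] a_def
    by (simp add: scaleR_sum_right divide_inverse mult.commute)
  have zD: "z i \<in> D" if "i \<in> {1..k}" for i using that z_in[of "i - 1"] by simp
  show "ergodic lam z k \<in> D" unfolding Z using a zD convex_D by (intro convex_sum) auto
  have "G (ergodic lam z k) \<le> (\<Sum>i=1..k. a i * G (z i))"
    unfolding Z using assms a zD by (intro convex_on_sum[OF _ _ convex_on_G]) auto
  moreover have "inner (F u) (ergodic lam z k) = (\<Sum>i=1..k. a i * inner (F u) (z i))"
    unfolding Z by (simp add: inner_sum_right)
  moreover have "(\<Sum>i=1..k. a i * gap u (z i)) = (\<Sum>i=1..k. a i * inner (F u) (z i)) + (\<Sum>i=1..k. a i * G (z i))
      - (\<Sum>i=1..k. a i) * (inner (F u) u + G u)"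
    unfolding gap_def sum_distrib_right sum.distrib[symmetric] sum_subtractf[symmetric]
    by (intro sum.cong) (auto simp: algebra_simps inner_diff_right)
  ultimately have "gap u (ergodic lam z k) \<le> (\<Sum>i=1..k. a i * gap u (z i))"
    unfolding a(1) by (simp add: gap_def inner_diff_right)
  then have "S * gap u (ergodic lam z k) \<le> S * (\<Sum>i=1..k. a i * gap u (z i))"
    using S by (intro mult_left_mono) auto
  also have "\<dots> = (\<Sum>i=1..k. lam i * gap u (z i))" using S by (simp add: sum_distrib_left a_def)
  finally show "(\<Sum>i=1..k. lam i) * gap u (ergodic lam z k) \<le> (\<Sum>i=1..k. lam i * gap u (z i))"
    unfolding S_def .
qed

text \<open>The energy inequality combines two proximal steps and \<open>z 1\<close> is an input, so
  telescoping covers the gaps from \<open>z 2\<close> on; the gap at \<open>z 1\<close> remains as a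
  separate term.\<close>

lemma weighted_gap_sum_le:
  assumes "u \<in> D" "k \<ge> 1"
  shows "(\<Sum>i=1..k. lam i * gap u (z i)) \<le> lam 1 * gap u (z 1) + energy u 1 / 2"
proof -
  obtain n where n: "k = Suc n" using assms(2) by (metis Suc_le_D One_nat_def)
  have "(\<Sum>i=1..k. lam i * gap u (z i)) = (\<Sum>i<Suc n. lam (Suc i) * gap u (z (Suc i)))"
    unfolding n using sum.atLeast1_atMost_eq[of "\<lambda>i. lam i * gap u (z i)" "Suc n"] by simp
  also have "\<dots> = lam 1 * gap u (z 1) + (\<Sum>i<n. lam (Suc (Suc i)) * gap u (z (Suc (Suc i))))"
    by (subst sum.lessThan_Suc_shift) simp
  also have "(\<Sum>i<n. lam (Suc (Suc i)) * gap u (z (Suc (Suc i)))) =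
      (\<Sum>i<n. 2 * lam (Suc (Suc i)) * gap u (z (Suc (Suc i)))) / 2"
    by (simp add: sum_divide_distrib)
  also have "\<dots> \<le> energy u 1 / 2"
    using sum_gap_le[OF assms(1), of n] energy_nonneg[of u n] by simp
  finally show ?thesis by simp
qed

text \<open>\<open>F\<close> may be unbounded on the ball, but monotonicity moves its argument to \<open>z\<^sup>1\<close>.\<close>
lemma initial_gap_bounded:
  "\<exists>M>0. \<forall>u\<in>D \<inter> cball xt r. lam 1 * gap u (z 1) + energy u 1 / 2 \<le> M"
proof -
  obtain m where m: "\<And>u. u \<in> D \<inter> cball xt r \<Longrightarrow> m \<le> G u"
    using bounded_below_on_bounded[OF bounded_cball, of xt r] by blast
  define b where "b = norm (F (z 1)) * (norm (z 1) + (norm xt + \<bar>r\<bar>)) + \<bar>G (z 1)\<bar> + \<bar>m\<bar>"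
  define e where "e = \<phi> / (\<phi> - 1) * (norm (zb 2) + (norm xt + \<bar>r\<bar>))\<^sup>2 + \<bar>th 1 / 2 * (norm (z 2 - z 1))\<^sup>2\<bar>"
  define M where "M = \<bar>lam 1 * b\<bar> + \<bar>e\<bar> + 1"
  have "lam 1 * gap u (z 1) + energy u 1 / 2 \<le> M" if u: "u \<in> D \<inter> cball xt r" for u
  proof -
    have nu: "norm u \<le> norm xt + \<bar>r\<bar>"
      using u norm_triangle_sub[of u xt] abs_ge_self[of r] by (simp add: dist_norm norm_minus_commute)
    have "inner (F u) (z 1 - u) \<le> inner (F (z 1)) (z 1 - u)"
      using F_mono[of "z 1" u] z_in[of 0] u by (simp add: inner_diff_left)
    also have "\<dots> \<le> norm (F (z 1)) * norm (z 1 - u)" by (rule norm_cauchy_schwarz)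
    also have "\<dots> \<le> norm (F (z 1)) * (norm (z 1) + (norm xt + \<bar>r\<bar>))"
      using norm_triangle_ineq4[of "z 1" u] nu by (intro mult_left_mono) auto
    finally have "gap u (z 1) \<le> b" using m[OF u] unfolding gap_def b_def by linarith
    then have "lam 1 * gap u (z 1) \<le> lam 1 * b" using lam_pos[of 1] by (intro mult_left_mono) auto
    moreover have "energy u 1 \<le> e"
    proof -
      have "norm (zb 2 - u) \<le> norm (zb 2) + (norm xt + \<bar>r\<bar>)"
        using norm_triangle_ineq4[of "zb 2" u] nu by simp
      then have "(norm (zb 2 - u))\<^sup>2 \<le> (norm (zb 2) + (norm xt + \<bar>r\<bar>))\<^sup>2" by (intro power_mono) auto
      then have "\<phi> / (\<phi> - 1) * (norm (zb 2 - u))\<^sup>2 \<le> \<phi> / (\<phi> - 1) * (norm (zb 2) + (norm xt + \<bar>r\<bar>))\<^sup>2"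
        using phi_gt by (intro mult_left_mono) auto
      moreover have "energy u 1 = \<phi> / (\<phi> - 1) * (norm (zb 2 - u))\<^sup>2 + th 1 / 2 * (norm (z 2 - z 1))\<^sup>2"
        unfolding energy_def by (simp add: numeral_2_eq_2)
      ultimately show ?thesis unfolding e_def by linarith
    qed
    ultimately show ?thesis unfolding M_def by linarith
  qed
  moreover have "M > 0" unfolding M_def by linarith
  ultimately show ?thesis by blast
qed

theorem ergodic_rate:
  "(\<exists>M>0. \<forall>k\<ge>1. \<forall>u\<in>D \<inter> cball xt r. gap u (ergodic lam z k) \<le> M / (\<Sum>i=1..k. lam i)) \<and>
   (\<exists>C>0. \<forall>k\<ge>1. \<forall>u\<in>D \<inter> cball xt r. gap u (ergodic lam z k) \<le> C / real k)"
proof -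
  obtain M where M: "M > 0" "\<And>u. u \<in> D \<inter> cball xt r \<Longrightarrow> lam 1 * gap u (z 1) + energy u 1 / 2 \<le> M"
    using initial_gap_bounded[of xt r] by blast
  obtain c where c: "c > 0" "\<And>k. c * real k \<le> (\<Sum>i=1..k. lam i)" using sum_lam_ge_linear by blast
  have 1: "gap u (ergodic lam z k) \<le> M / (\<Sum>i=1..k. lam i)" if k: "k \<ge> 1" and u: "u \<in> D \<inter> cball xt r" for k u
  proof -
    have "(\<Sum>i=1..k. lam i) > 0" using k lam_pos by (intro sum_pos) auto
    moreover have "(\<Sum>i=1..k. lam i) * gap u (ergodic lam z k) \<le> M"
      using ergodic_gap_le(2)[OF k, of u] weighted_gap_sum_le[of u k] k u M(2)[OF u] by auto
    ultimately show ?thesis by (simp add: pos_le_divide_eq mult.commute)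
  qed
  have 2: "M / (\<Sum>i=1..k. lam i) \<le> (M / c) / real k" if k: "k \<ge> 1" for k
  proof -
    have "M / (\<Sum>i=1..k. lam i) \<le> M / (c * real k)"
      using M c k by (intro divide_left_mono) (auto intro!: mult_pos_pos sum_pos lam_pos)
    then show ?thesis by simp
  qed
  have "gap u (ergodic lam z k) \<le> (M / c) / real k" if k: "k \<ge> 1" and u: "u \<in> D \<inter> cball xt r" for k u
    using 1[OF that] 2[OF k] by (rule order_trans)
  moreover have "M / c > 0" using M c by simp
  ultimately show ?thesis using 1 M(1) by blast
qed

end

section \<open>Extended-real-valued functions and aGRAAL\<close>

lemma lsc_sequential:
  fixes g :: "'a::euclidean_space \<Rightarrow> ereal"
  assumes lsc: "lsc_fun g" and X: "X \<longlonglongrightarrow> x" and le: "\<And>n. g (X n) \<le> ereal (c n)" and c: "c \<longlonglongrightarrow> l"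
  shows "g x \<le> ereal l"
proof (rule ccontr)
  assume "\<not> ?thesis"
  then obtain y where y: "ereal l < ereal y" "ereal y < g x" using ereal_dense2[of "ereal l" "g x"] by (auto simp: not_le)
  have "ereal y < Liminf (at x) g" using lsc y(2) unfolding lsc_fun_def by (metis order_less_le_trans)
  then have "\<forall>\<^sub>F x' in at x. ereal y < g x'" using less_LiminfD by blast
  \<comment> \<open>\<open>lsc_fun\<close> speaks of punctured neighbourhoods. The bound on
    \<open>g x\<close> itself covers sequences that hit \<open>x\<close>.\<close>
  then have "\<forall>\<^sub>F x' in nhds x. ereal y < g x'"
    unfolding eventually_at_filter using y(2) by (auto elim: eventually_mono)
  then have "\<forall>\<^sub>F n in sequentially. ereal y < g (X n)" using X unfolding filterlim_iff by blast
  moreover have "\<forall>\<^sub>F n in sequentially. c n < y" using c y(1) by (intro order_tendstoD(2)) auto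
  ultimately have "\<forall>\<^sub>F n in sequentially. False"
  proof eventually_elim
    case (elim n)
    have "ereal y < ereal (c n)" using elim(1) le[of n] by (rule order_less_le_trans)
    then show ?case using elim(2) by simp
  qed
  then show False by simp
qed

lemma proper_fun_real:
  assumes "proper_fun g" "x \<in> effdom g"
  shows "g x = ereal (real_of_ereal (g x))"
  using assms unfolding proper_fun_def effdom_def by (cases "g x") auto

lemma closed_convex_function_effdom:
  fixes g :: "'a::euclidean_space \<Rightarrow> ereal"
  assumes proper: "proper_fun g" and conv: "convex_fun g" and lsc: "lsc_fun g"
  shows "closed_convex_function (effdom g) (\<lambda>x. real_of_ereal (g x))"
proof
  note real = proper_fun_real[OF proper]
  have *: "u *\<^sub>R x + v *\<^sub>R y \<in> effdom g \<and>
      real_of_ereal (g (u *\<^sub>R x + v *\<^sub>R y)) \<le> u * real_of_ereal (g x) + v * real_of_ereal (g y)"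
    if xy: "x \<in> effdom g" "y \<in> effdom g" and uv: "u \<ge> 0" "v \<ge> 0" "u + v = 1" for x y u v
  proof -
    have "g (u *\<^sub>R x + v *\<^sub>R y) \<le> ereal u * g x + ereal v * g y"
      using conv uv unfolding convex_fun_def by blast
    also have "\<dots> = ereal (u * real_of_ereal (g x) + v * real_of_ereal (g y))"
      by (subst (1 2) real) (use xy in auto)
    finally have le: "g (u *\<^sub>R x + v *\<^sub>R y) \<le> ereal (u * real_of_ereal (g x) + v * real_of_ereal (g y))" .
    then have "u *\<^sub>R x + v *\<^sub>R y \<in> effdom g" unfolding effdom_def by (auto intro: order_le_less_trans)
    with le real[OF this] show ?thesis by (metis ereal_less_eq(3))
  qed
  show "convex_on (effdom g) (\<lambda>x. real_of_ereal (g x))"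
    unfolding convex_on_def convex_def using * by blast
  fix X x c l
  assume X: "\<And>n. X n \<in> effdom g" "X \<longlonglongrightarrow> x" "\<And>n. real_of_ereal (g (X n)) \<le> c n" "c \<longlonglongrightarrow> l"
  have "g (X n) \<le> ereal (c n)" for n using X(3)[of n] real[OF X(1)[of n]] by (metis ereal_less_eq(3))
  then have le: "g x \<le> ereal l" using lsc_sequential[OF lsc X(2) _ X(4)] by blast
  then have "x \<in> effdom g" unfolding effdom_def by (auto intro: order_le_less_trans)
  with le real[OF this] show "x \<in> effdom g \<and> real_of_ereal (g x) \<le> l" by (metis ereal_less_eq(3))
qed

text \<open>\<open>prox\<close> is a choice operator, so a minimizer must exist before anything is
  known of its value. A minimizer over \<open>effdom g\<close> is one everywhere, because the
  objective is infinite elsewhere.\<close>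

lemma prox_characterization:
  fixes g :: "'a::euclidean_space \<Rightarrow> ereal"
  assumes proper: "proper_fun g" and conv: "convex_fun g" and lsc: "lsc_fun g" and t: "t > 0"
  shows "prox t g w \<in> effdom g"
    and "u \<in> effdom g \<Longrightarrow> t * (real_of_ereal (g (prox t g w)) - real_of_ereal (g u))
      \<le> inner (prox t g w - w) (u - prox t g w)"
proof -
  interpret closed_convex_function "effdom g" "\<lambda>x. real_of_ereal (g x)"
    using proper conv lsc by (rule closed_convex_function_effdom)
  note real = proper_fun_real[OF proper]
  define h where "h x = ereal t * g x + ereal (1/2 * (norm (x - w))\<^sup>2)" for x
  have h: "h x = ereal (t * real_of_ereal (g x) + 1/2 * (norm (x - w))\<^sup>2)" if "x \<in> effdom g" for x
    unfolding h_def by (subst real[OF that]) simp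
  have h_inf: "h x = \<infinity>" if "x \<notin> effdom g" for x
    using that t unfolding h_def effdom_def by simp
  obtain x where x: "x \<in> effdom g" "\<And>y. y \<in> effdom g \<Longrightarrow>
      t * real_of_ereal (g x) + 1/2 * (norm (x - w))\<^sup>2 \<le> t * real_of_ereal (g y) + 1/2 * (norm (y - w))\<^sup>2"
    using proximal_minimizer_exists[OF _ t, of w] proper unfolding proper_fun_def by blast
  have "h x \<le> h y" for y
    using x h h_inf by (cases "y \<in> effdom g") auto
  then have "is_arg_min h (\<lambda>_. True) x" by (simp add: is_arg_min_def not_less)
  then have "is_arg_min h (\<lambda>_. True) (prox t g w)"
    unfolding prox_def arg_min_def h_def by (rule someI)
  then have min: "h (prox t g w) \<le> h y" for y by (simp add: is_arg_min_def not_less)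
  show in_dom: "prox t g w \<in> effdom g"
  proof (rule ccontr)
    assume "prox t g w \<notin> effdom g"
    then show False using min[of x] h[OF x(1)] h_inf by simp
  qed
  show "t * (real_of_ereal (g (prox t g w)) - real_of_ereal (g u))
      \<le> inner (prox t g w - w) (u - prox t g w)" if "u \<in> effdom g"
    using in_dom _ t that
  proof (rule proximal_inequality)
    show "t * real_of_ereal (g (prox t g w)) + 1/2 * (norm (prox t g w - w))\<^sup>2
        \<le> t * real_of_ereal (g y) + 1/2 * (norm (y - w))\<^sup>2" if "y \<in> effdom g" for y
      using min[of y] h[OF in_dom] h[OF that] by simp
  qed
qed

lemma aGRAAL_step_size:
  assumes alg: "aGRAAL g F \<phi> lbar z zb lam th"
  shows "lam k > 0" "th k > 0"
    and "lam (Suc k) \<le> (1 / \<phi> + 1 / \<phi>\<^sup>2) * lam k" "lam (Suc k) \<le> lbar"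
    and "4 * lam (Suc k) * lam k * (norm (F (z (Suc k)) - F (z k)))\<^sup>2
          \<le> \<phi> * th k * (norm (z (Suc k) - z k))\<^sup>2"
    and "lam (Suc k) = (1 / \<phi> + 1 / \<phi>\<^sup>2) * lam k \<or> lam (Suc k) = lbar \<or>
          (F (z (Suc k)) \<noteq> F (z k) \<and> 4 * lam (Suc k) * lam k * (norm (F (z (Suc k)) - F (z k)))\<^sup>2
            = \<phi> * th k * (norm (z (Suc k) - z k))\<^sup>2)"
proof -
  have phi: "\<phi> > 1" and lbar: "lbar > 0" and init: "lam 0 > 0" "th 0 = 1"
    using alg unfolding aGRAAL_def by auto
  have th: "th (Suc k) = \<phi> * lam (Suc k) / lam k" for k
    using alg unfolding aGRAAL_def by (metis diff_Suc_1 le_add1 plus_1_eq_Suc)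
  define q where "q k = \<phi> * th k / (4 * lam k) * ((norm (z (Suc k) - z k))\<^sup>2 / (norm (F (z (Suc k)) - F (z k)))\<^sup>2)" for k
  have lam: "ereal (lam (Suc k)) = min (ereal ((1 / \<phi> + 1 / \<phi>\<^sup>2) * lam k))
      (min (ereal (\<phi> * th k / (4 * lam k)) * quot ((norm (z (Suc k) - z k))\<^sup>2) ((norm (F (z (Suc k)) - F (z k)))\<^sup>2))
        (ereal lbar))" for k
    using alg unfolding aGRAAL_def by (metis diff_Suc_1 le_add1 plus_1_eq_Suc)
  \<comment> \<open>Positivity is assumed because in \<open>ereal\<close> the infinite quotient
    stays infinite only after multiplication by a positive factor; hence \<open>lam\<close> and
    \<open>th\<close> are proved positive by a joint induction.\<close>
  have lam': "lam (Suc k) = (if F (z (Suc k)) = F (z k) then min ((1 / \<phi> + 1 / \<phi>\<^sup>2) * lam k) lbar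
      else min ((1 / \<phi> + 1 / \<phi>\<^sup>2) * lam k) (min (q k) lbar))" if "lam k > 0" "th k > 0" for k
  proof (cases "F (z (Suc k)) = F (z k)")
    case True
    have scale_inf: "ereal C * \<infinity> = \<infinity>" if "C > 0" for C using that by simp
    have quot_inf: "quot ((norm (z (Suc k) - z k))\<^sup>2) ((norm (F (z (Suc k)) - F (z k)))\<^sup>2) = \<infinity>"
      using True by (simp add: quot_def)
    have "\<phi> * th k / (4 * lam k) > 0" using that phi by simp
    from lam[of k, unfolded quot_inf scale_inf[OF this]]
    have "ereal (lam (Suc k)) = min (ereal ((1 / \<phi> + 1 / \<phi>\<^sup>2) * lam k)) (ereal lbar)"
      by (simp add: min_def)
    then show ?thesis using True by (simp add: min_def split: if_splits)
  next
    case False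
    then have "ereal (lam (Suc k)) = min (ereal ((1 / \<phi> + 1 / \<phi>\<^sup>2) * lam k)) (min (ereal (q k)) (ereal lbar))"
      using lam[of k] by (simp add: quot_def q_def)
    then show ?thesis using False by (simp add: min_def split: if_splits)
  qed
  have pos: "lam k > 0 \<and> th k > 0" for k
  proof (induction k)
    case 0
    then show ?case using init by simp
  next
    case (Suc k)
    have "1 / \<phi> + 1 / \<phi>\<^sup>2 > 0" using phi by (intro add_pos_pos) auto
    moreover have "q k > 0" if "F (z (Suc k)) \<noteq> F (z k)"
    proof -
      \<comment> \<open>A nonzero denominator forces a nonzero numerator, so the quotient never
        produces a zero step.\<close>
      have "z (Suc k) \<noteq> z k" using that by auto
      then show ?thesis unfolding q_def using that Suc phi by (intro mult_pos_pos divide_pos_pos) auto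
    qed
    ultimately have "lam (Suc k) > 0" using lam'[of k] Suc lbar by (auto intro!: mult_pos_pos)
    then show ?case using Suc phi by (simp add: th)
  qed
  show "lam k > 0" "th k > 0" using pos by auto
  note lam'' = lam'[OF conjunct1[OF pos] conjunct2[OF pos]]
  show "lam (Suc k) \<le> (1 / \<phi> + 1 / \<phi>\<^sup>2) * lam k" "lam (Suc k) \<le> lbar"
    using lam''[of k] by (auto simp: min_le_iff_disj split: if_splits)
  let ?f = "(norm (F (z (Suc k)) - F (z k)))\<^sup>2" and ?d = "(norm (z (Suc k) - z k))\<^sup>2"
  have q: "4 * q k * lam k * ?f = \<phi> * th k * ?d" if "F (z (Suc k)) \<noteq> F (z k)"
    using that pos[of k] by (simp add: q_def field_simps)
  show "4 * lam (Suc k) * lam k * ?f \<le> \<phi> * th k * ?d"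
  proof (cases "F (z (Suc k)) = F (z k)")
    case True
    then show ?thesis using phi pos[of k] by simp
  next
    case False
    then have "lam (Suc k) \<le> q k" using lam''[of k] by (auto simp: min_le_iff_disj)
    then have "4 * lam (Suc k) * lam k * ?f \<le> 4 * q k * lam k * ?f"
      using pos[of k] by (intro mult_right_mono) auto
    then show ?thesis using q[OF False] by simp
  qed
  show "lam (Suc k) = (1 / \<phi> + 1 / \<phi>\<^sup>2) * lam k \<or> lam (Suc k) = lbar \<or>
      (F (z (Suc k)) \<noteq> F (z k) \<and> 4 * lam (Suc k) * lam k * ?f = \<phi> * th k * ?d)"
    using lam''[of k] q by (auto simp: min_def split: if_splits)
qed

text \<open>Completing the square turns the claim into
  \<open>(2 * \<phi> - 1)\<^sup>2 \<le> 5\<close>.\<close>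

lemma golden_ratio_square_le:
  assumes "1 < (\<phi>::real)" "\<phi> \<le> (sqrt 5 + 1) / 2"
  shows "\<phi>\<^sup>2 \<le> \<phi> + 1"
proof -
  have "0 \<le> 2 * \<phi> - 1" "2 * \<phi> - 1 \<le> sqrt 5" using assms by auto
  then have "(2 * \<phi> - 1)\<^sup>2 \<le> (sqrt 5)\<^sup>2" by (intro power_mono) auto
  then show ?thesis by (simp add: power2_eq_square algebra_simps)
qed

lemma golden_ratio_iteration_aGRAAL:
  fixes g :: "'a::euclidean_space \<Rightarrow> ereal"
  assumes proper: "proper_fun g" and conv: "convex_fun g" and lsc: "lsc_fun g"
    and mono: "monotone_operator_on (effdom g) F"
    and lip: "locally_lipschitz_on (effdom g) F"
    and zs: "zs \<in> VI_solutions g F"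
    and alg: "aGRAAL g F \<phi> lbar z zb lam th"
  shows "golden_ratio_iteration (effdom g) (\<lambda>x. real_of_ereal (g x)) F \<phi> lbar z zb lam th zs"
proof -
  interpret closed_convex_function "effdom g" "\<lambda>x. real_of_ereal (g x)"
    using proper conv lsc by (rule closed_convex_function_effdom)
  note real = proper_fun_real[OF proper]
  note prox = prox_characterization[OF proper conv lsc]
  have step: "zb (Suc k) = ((\<phi> - 1) *\<^sub>R z (Suc k) + zb k) /\<^sub>R \<phi>"
    "z (Suc (Suc k)) = prox (lam (Suc k)) g (zb (Suc k) - lam (Suc k) *\<^sub>R F (z (Suc k)))"
    "th (Suc k) = \<phi> * lam (Suc k) / lam k" for k
    using alg unfolding aGRAAL_def by (metis Suc_eq_plus1 diff_Suc_1 le_add2)+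
  have init: "z 1 \<in> effdom g" "1 < \<phi>" "\<phi> \<le> (sqrt 5 + 1) / 2" "lbar > 0" "zb 0 = z 1"
    using alg unfolding aGRAAL_def by auto
  note size = aGRAAL_step_size[OF alg]
  have zs_dom: "zs \<in> effdom g" using zs unfolding VI_solutions_def by auto
  show ?thesis
  proof
    show "0 \<le> inner (F u - F v) (u - v)" if "u \<in> effdom g" "v \<in> effdom g" for u v
      using mono that unfolding monotone_operator_on_def by blast
    show "\<exists>\<delta>>0. \<exists>L. L-lipschitz_on (cball x \<delta> \<inter> effdom g) F" if "x \<in> effdom g" for x
      using lip that unfolding locally_lipschitz_on_def by blast
    show "zs \<in> effdom g" by (rule zs_dom)
    show "0 \<le> inner (F zs) (u - zs) + real_of_ereal (g u) - real_of_ereal (g zs)" if "u \<in> effdom g" for u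
    proof -
      have "0 \<le> ereal (inner (F zs) (u - zs)) + g u - g zs" using zs unfolding VI_solutions_def by blast
      also have "\<dots> = ereal (inner (F zs) (u - zs) + real_of_ereal (g u) - real_of_ereal (g zs))"
        by (subst real[OF that], subst real[OF zs_dom]) simp
      finally show ?thesis by simp
    qed
    show "1 < \<phi>" "\<phi>\<^sup>2 \<le> \<phi> + 1" "0 < lbar" "zb 0 = z (Suc 0)"
      using init golden_ratio_square_le[of \<phi>] by auto
    show z_in: "z (Suc k) \<in> effdom g" for k
      using init(1) prox(1)[OF size(1)] step(2) by (cases k) auto
    show "lam (Suc k) * (real_of_ereal (g (z (Suc (Suc k)))) - real_of_ereal (g u))
      \<le> inner (z (Suc (Suc k)) - zb (Suc k) + lam (Suc k) *\<^sub>R F (z (Suc k))) (u - z (Suc (Suc k)))"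
      if "u \<in> effdom g" for u k
      using prox(2)[OF size(1)[of "Suc k"] that, of "zb (Suc k) - lam (Suc k) *\<^sub>R F (z (Suc k))"]
      unfolding step(2)[symmetric] by (simp add: algebra_simps)
  qed (use size step in blast)+
qed

theorem mainTheorem3:
  fixes g :: "'a::euclidean_space \<Rightarrow> ereal" and F :: "'a \<Rightarrow> 'a"
    and \<phi> lbar r :: real and z zb :: "nat \<Rightarrow> 'a" and lam th :: "nat \<Rightarrow> real" and xt :: 'a
  assumes "proper_fun g" and "convex_fun g" and "lsc_fun g"
    and "monotone_operator_on (effdom g) F"
    and "locally_lipschitz_on (effdom g) F"
    and "VI_solutions g F \<noteq> {}"
    and "aGRAAL g F \<phi> lbar z zb lam th"
    and "xt \<in> effdom g" and "r > 0"
  shows "(\<exists>M>0. \<forall>k\<ge>1. restricted_gap g F xt r (ergodic lam z k) \<le> ereal (M / (\<Sum>i=1..k. lam i)))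
    \<and> (\<exists>C>0. \<forall>k\<ge>1. restricted_gap g F xt r (ergodic lam z k) \<le> ereal (C / real k))"
proof -
  obtain zs where "zs \<in> VI_solutions g F" using assms(6) by blast
  then interpret golden_ratio_iteration "effdom g" "\<lambda>x. real_of_ereal (g x)" F \<phi> lbar z zb lam th zs
    using assms by (intro golden_ratio_iteration_aGRAAL)
  note real = proper_fun_real[OF assms(1)]
  \<comment> \<open>For \<open>k \<ge> 1\<close> the ergodic point lies in the domain, so every term
    under the supremum is finite and a uniform real bound suffices.\<close>
  have gap_le: "restricted_gap g F xt r (ergodic lam z k) \<le> ereal B"
    if k: "k \<ge> 1" and B: "\<forall>u\<in>effdom g \<inter> cball xt r. gap u (ergodic lam z k) \<le> B" for k B
    unfolding restricted_gap_def
  proof (rule SUP_least)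
    fix u assume u: "u \<in> effdom g \<inter> cball xt r"
    then have uD: "u \<in> effdom g" by simp
    have "ereal (inner (F u) (ergodic lam z k - u)) + g (ergodic lam z k) - g u = ereal (gap u (ergodic lam z k))"
      by (subst real[OF ergodic_gap_le(1)[OF k uD]], subst real[OF uD]) (simp add: gap_def)
    then show "ereal (inner (F u) (ergodic lam z k - u)) + g (ergodic lam z k) - g u \<le> ereal B"
      using B u by simp
  qed
  show ?thesis using ergodic_rate[of xt r] gap_le by meson
qed

end
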